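(* Let $n\ge1$, $r>1$ and $\sigma_0>0$. There exist constants $0<c\le C<\infty$, depending only on $r$ and $\sigma_0$, such that every $u\in L^2(\mathbb{R}^n)$ satisfies $$c\,\|u\|_{L^2}^2\le\sum_{s\in\mathbb{Z}}\|u*\Phi_s\|_{L^2}^2\le C\,\|u\|_{L^2}^2.$$
   Context: For $\sigma>0$ let $\gamma_\sigma(x)=(2\pi\sigma^2)^{-n/2}\exp(-|x|^2/(2\sigma^2))$ on $\mathbb{R}^n$. For $s\in\mathbb{Z}$ put $\sigma_s=r^s\sigma_0$. The $r$-adic difference-of-Gaussians filters are $\Phi_s=\gamma_{\sigma_s}-\gamma_{\sigma_{s-1}}$, $s\in\mathbb{Z}$. *)

theory Defs
  imports "HOL-Analysis.Analysis"
begin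

text \<open>
  The constants in the frame bounds must not depend on the dimension \<open>n\<close>, so \<open>n\<close> is quantified
  inside the formula and cannot be the cardinality of an index type. Points of \<open>\<real>\<^sup>n\<close> are
  therefore functions \<open>nat \<Rightarrow> real\<close> that are \<open>undefined\<close> outside \<open>{..<n}\<close>, i.e.\ elements of
  \<open>{..<n} \<rightarrow>\<^sub>E UNIV\<close>. The completion yields all Lebesgue measurable sets, not only Borel sets.
\<close>

definition lebesgue_Rn :: "nat \<Rightarrow> (nat \<Rightarrow> real) measure" where
  "lebesgue_Rn n = completion (Pi\<^sub>M {..<n} (\<lambda>_. lborel))"

definition diff_Rn :: "nat \<Rightarrow> (nat \<Rightarrow> real) \<Rightarrow> (nat \<Rightarrow> real) \<Rightarrow> (nat \<Rightarrow> real)" where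
  "diff_Rn n x y = (\<lambda>i\<in>{..<n}. x i - y i)"

definition norm_Rn :: "nat \<Rightarrow> (nat \<Rightarrow> real) \<Rightarrow> real" where
  "norm_Rn n x = L2_set x {..<n}"

text \<open>Representatives of the classes in \<open>L\<^sup>2(\<real>\<^sup>n)\<close>, complex-valued.\<close>

definition L2_Rn :: "nat \<Rightarrow> ((nat \<Rightarrow> real) \<Rightarrow> complex) set" where
  "L2_Rn n = {u \<in> borel_measurable (lebesgue_Rn n).
                integrable (lebesgue_Rn n) (\<lambda>x. (cmod (u x))\<^sup>2)}"

definition L2_norm :: "nat \<Rightarrow> ((nat \<Rightarrow> real) \<Rightarrow> complex) \<Rightarrow> real" where
  "L2_norm n u = sqrt (LINT x|lebesgue_Rn n. (cmod (u x))\<^sup>2)"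

definition convolution_Rn ::
  "nat \<Rightarrow> ((nat \<Rightarrow> real) \<Rightarrow> complex) \<Rightarrow> ((nat \<Rightarrow> real) \<Rightarrow> real) \<Rightarrow> (nat \<Rightarrow> real) \<Rightarrow> complex" where
  "convolution_Rn n u \<phi> x = (LINT y|lebesgue_Rn n. u y * complex_of_real (\<phi> (diff_Rn n x y)))"

definition gaussian :: "nat \<Rightarrow> real \<Rightarrow> (nat \<Rightarrow> real) \<Rightarrow> real" where
  "gaussian n \<sigma> x =
     (2 * pi * \<sigma>\<^sup>2) powr (- real n / 2) * exp (- (norm_Rn n x)\<^sup>2 / (2 * \<sigma>\<^sup>2))"

definition scale :: "real \<Rightarrow> real \<Rightarrow> int \<Rightarrow> real" where
  "scale r \<sigma>0 s = r powi s * \<sigma>0"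

definition DoG_filter :: "nat \<Rightarrow> real \<Rightarrow> real \<Rightarrow> int \<Rightarrow> (nat \<Rightarrow> real) \<Rightarrow> real" where
  "DoG_filter n r \<sigma>0 s x = gaussian n (scale r \<sigma>0 s) x - gaussian n (scale r \<sigma>0 (s - 1)) x"

end

theory Submission
  imports Defs "HOL-Probability.Probability"
begin

text \<open>
  Convolution with \<open>\<gamma>\<close> of variance \<open>t\<close> is the heat semigroup \<open>T t\<close>. With
  \<open>F t = \<langle>f, T t f\<rangle>\<close>, symmetry and the semigroup law give
  \<open>\<parallel>T a f - T b f\<parallel>\<^sup>2 = F (2 a) - 2 F (a + b) + F (2 b)\<close>, so the frame sum is a sum of second
  differences of the single real function \<open>F\<close> along a geometric progression, and no Fourier
  transform is needed. Contractivity of \<open>T\<close> makes \<open>F\<close> decreasing and convex with second differences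
  that decrease in the base point; moreover \<open>F t\<close> tends to \<open>F 0 = \<parallel>f\<parallel>\<^sup>2\<close> as \<open>t \<rightarrow> 0\<close> and to \<open>0\<close> as
  \<open>t \<rightarrow> \<infinity>\<close>. The upper bound holds because each second difference is at most a first difference
  of \<open>F\<close>, and these telescope. The lower bound is a discrete version of \<open>F 0 = \<integral> t F'' t dt\<close>: since
  \<open>F''\<close> is decreasing, the second difference over one band controls \<open>\<integral> t F'' t dt\<close> over the next.
\<close>

section \<open>Convex decay along a geometric progression\<close>

text \<open>Contraction applies to differences of the \<open>T t f\<close> as well. This gives a
  third-order sign condition on \<open>F\<close>, which bounds curvature far out by curvature nearer
  to 0; the lower bound rests on it. The frame constants come from such inequalities for one real
  function, so no dimension enters them, and \<sigma>0 only fixes where the geometric progression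
  starts.

  The analytic work lies in the two limits of \<open>F\<close>. At infinity, the kernel maps L1 to
  bounded functions with a norm that tends to 0, and integrable functions are dense in L2. At 0, the
  functions with the right limit form a closed subspace, so indicators of boxes suffice; their
  energies factor over the coordinates, and only the heat kernel on the line has to be examined for
  small times.

  A last obstacle is the form of the input: \<open>u\<close> is complex and measurable only for the
  completed measure, whereas Fubini is used for the Borel product. Real Borel representatives of the
  two parts of \<open>u\<close> bridge this.\<close>

lemma midpoint_convex_imp_convex_on:
  fixes f :: "real \<Rightarrow> real"
  assumes cont: "continuous_on {a..b} f"
    and mid: "\<And>x h. a \<le> x \<Longrightarrow> 0 \<le> h \<Longrightarrow> x + 2 * h \<le> b \<Longrightarrow> 2 * f (x + h) \<le> f x + f (x + 2 * h)"
  shows "convex_on {a..b} f"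
proof -
  have chord: "f z \<le> f x + (f y - f x) / (y - x) * (z - x)"
    if xy: "a \<le> x" "x < y" "y \<le> b" and z: "z \<in> {x..y}" for x y z
  proof (rule ccontr)
    assume neg: "\<not> ?thesis"
    define g where "g t = f t - (f x + (f y - f x) / (y - x) * (t - x))" for t
    have contg: "continuous_on {x..y} g"
      unfolding g_def using xy by (intro continuous_intros continuous_on_subset[OF cont]) auto
    obtain c0 where c0: "c0 \<in> {x..y}" "\<And>t. t \<in> {x..y} \<Longrightarrow> g t \<le> g c0"
      using continuous_attains_sup[OF compact_Icc _ contg] xy by (metis atLeastAtMost_iff less_imp_le empty_iff order_refl)
    define Z where "Z = {t \<in> {x..y}. g t = g c0}"
    have "closed Z"
      unfolding Z_def by (rule continuous_closed_preimage_constant[OF contg]) simp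
    then have "compact Z"
      using compact_Int_closed[OF compact_Icc, of Z x y] by (auto simp: Z_def Int_def cong: conj_cong)
    moreover have "Z \<noteq> {}" using c0 by (auto simp: Z_def)
    \<comment> \<open>The leftmost maximum point makes \<open>g (c - h) < g c\<close> strict, so
      midpoint convexity at \<open>c\<close> fails.\<close>
    ultimately obtain c where c: "c \<in> Z" "\<And>t. t \<in> Z \<Longrightarrow> c \<le> t"
      using compact_attains_inf by metis
    have pos: "g c > 0"
      using c(1) c0(2)[OF z] neg by (auto simp: Z_def g_def)
    have "g x = 0" "g y = 0" using xy by (auto simp: g_def)
    then have cxy: "x < c" "c < y"
      using pos c(1) by (auto simp: Z_def less_le)
    define h where "h = min (c - x) (y - c)"
    have h: "0 < h" "x \<le> c - h" "c + h \<le> y" using cxy by (auto simp: h_def)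
    have "c - h \<notin> Z" using c(2)[of "c - h"] h by auto
    then have "g (c - h) < g c"
      using h c0(2)[of "c - h"] c(1) by (auto simp: Z_def)
    moreover have "g (c + h) \<le> g c"
      using h c0(2)[of "c + h"] c(1) by (auto simp: Z_def)
    moreover have "2 * f c \<le> f (c - h) + f (c + h)"
      using mid[of "c - h" h] h xy by (simp add: algebra_simps)
    then have "2 * g c \<le> g (c - h) + g (c + h)"
      by (simp add: g_def algebra_simps add_divide_distrib diff_divide_distrib)
    ultimately show False by simp
  qed
  show ?thesis
  proof (rule convex_onI)
    fix t x y :: real
    assume t: "0 < t" "t < 1" and x: "x \<in> {a..b}" and y: "y \<in> {a..b}"
    have *: "f ((1 - t) * x + t * y) \<le> (1 - t) * f x + t * f y"
      if "x < y" "x \<in> {a..b}" "y \<in> {a..b}" "0 < t" "t < 1" for x y t :: real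
    proof -
      have 1: "(1 - t) * x + t * y = x + t * (y - x)" by (simp add: algebra_simps)
      have "t * (y - x) \<le> 1 * (y - x)" using that by (intro mult_right_mono) auto
      then have "x + t * (y - x) \<le> y" by simp
      then have "(1 - t) * x + t * y \<in> {x..y}" unfolding 1 using that by simp
      from chord[OF _ that(1) _ this] that(2,3)
      have "f (x + t * (y - x)) \<le> f x + (f y - f x) / (y - x) * (t * (y - x))" unfolding 1 by simp
      moreover have "(f y - f x) / (y - x) * (t * (y - x)) = t * (f y - f x)" using that(1) by simp
      ultimately show ?thesis unfolding 1 by (simp add: algebra_simps)
    qed
    consider "x < y" | "x = y" | "y < x" by linarith
    then show "f ((1 - t) *\<^sub>R x + t *\<^sub>R y) \<le> (1 - t) * f x + t * f y"
    proof cases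
      case 1
      then show ?thesis using *[of x y t] x y t by simp
    next
      case 2
      then show ?thesis by (simp add: algebra_simps)
    next
      case 3
      then show ?thesis using *[of y x "1 - t"] x y t by (simp add: algebra_simps)
    qed
  qed simp
qed

text \<open>The ceiling counts steps of length \<open>(q - 1) * node s / 2\<close> from
  \<open>node (s + 1)\<close> to \<open>node (s + 3)\<close>; the quotient is
  \<open>2 * q * (q + 1)\<close>. The factor \<open>2 * q\<^sup>2\<close> is the length from
  \<open>node (s + 2)\<close> to \<open>node (s + 3)\<close> divided by that step. The divisor
  \<open>q - 1\<close> is what remains of \<open>q * gap s - gap (s + 1)\<close> after summation
  over \<open>s\<close>.\<close>

definition frame_const :: "real \<Rightarrow> real" where
  "frame_const q = 2 * q\<^sup>2 * (real (nat \<lceil>2 * q * (q + 1)\<rceil>) + 1) / (q - 1)"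

lemma frame_const_pos: "1 < q \<Longrightarrow> 0 < frame_const q"
  unfolding frame_const_def by (intro divide_pos_pos mult_pos_pos add_nonneg_pos of_nat_0_le_iff) auto

text \<open>The inequalities are finite-difference forms of F' <= 0, F'' >= 0 and F''' <= 0, so that
  differentiability of the energy is never an issue. The model is the Laplace transform of a finite
  positive measure on the open half line.\<close>

locale decay_profile =
  fixes F :: "real \<Rightarrow> real"
  assumes antimono: "0 \<le> s \<Longrightarrow> s \<le> t \<Longrightarrow> F t \<le> F s"
    and diff2_nonneg: "0 \<le> t \<Longrightarrow> 0 \<le> h \<Longrightarrow> 0 \<le> F t - 2 * F (t + h) + F (t + 2 * h)"
    and diff2_antimono: "0 \<le> s \<Longrightarrow> s \<le> t \<Longrightarrow> 0 \<le> h \<Longrightarrow>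
      F t - 2 * F (t + h) + F (t + 2 * h) \<le> F s - 2 * F (s + h) + F (s + 2 * h)"
    and tendsto_0: "(F \<longlongrightarrow> F 0) (at_right 0)"
    and tendsto_inf: "(F \<longlongrightarrow> 0) at_top"
begin

definition diff2 :: "real \<Rightarrow> real \<Rightarrow> real" where
  "diff2 t h = F t - 2 * F (t + h) + F (t + 2 * h)"

lemma nonneg: "0 \<le> t \<Longrightarrow> 0 \<le> F t"
  by (rule tendsto_le[OF trivial_limit_at_top_linorder tendsto_const tendsto_inf])
     (auto intro!: eventually_at_top_linorderI[of t] antimono)

lemma increment_shift:
  assumes "0 \<le> a" "0 \<le> h"
  shows "F (a + real n * h) - F (a + real (Suc n) * h) \<le> F a - F (a + h)"
proof (induction n)
  case (Suc n)
  have "0 \<le> F (a + real n * h) - 2 * F (a + real n * h + h) + F (a + real n * h + 2 * h)"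
    using assms by (intro diff2_nonneg) auto
  then show ?case using Suc by (simp add: algebra_simps)
qed simp

text \<open>Moving \<open>t\<close> back by whole steps \<open>h\<close> ends at some
  \<open>a\<close> in [0, h] and does not decrease the increment; then [a, a + h] lies in [0, 2h].
  The bound is uniform in \<open>t\<close>, so continuity at 0 spreads to the whole half
  line.\<close>

lemma increment_le:
  assumes "0 \<le> t" "0 < h"
  shows "F t - F (t + h) \<le> F 0 - F (2 * h)"
proof -
  define n where "n = nat \<lfloor>t / h\<rfloor>"
  define a where "a = t - real n * h"
  have n: "real n \<le> t / h" "t / h < real n + 1"
    using assms by (auto simp: n_def)
  have a: "0 \<le> a" "a \<le> h" using n assms by (auto simp: a_def field_simps)
  have "F t - F (t + h) = F (a + real n * h) - F (a + real (Suc n) * h)"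
    by (simp add: a_def algebra_simps)
  also have "\<dots> \<le> F a - F (a + h)" using a assms by (intro increment_shift) auto
  also have "\<dots> \<le> F 0 - F (2 * h)"
    using antimono[of 0 a] antimono[of "a + h" "2 * h"] a assms by auto
  finally show ?thesis .
qed

lemma continuous: "continuous_on {0..} F"
proof (rule continuous_onI)
  fix x e :: real
  assume x: "x \<in> {0..}" and e: "0 < e"
  from tendsto_0 e have "\<forall>\<^sub>F h in at_right 0. dist (F h) (F 0) < e" by (rule tendstoD)
  then obtain b where b: "0 < b" "\<And>h. 0 < h \<Longrightarrow> h < b \<Longrightarrow> dist (F h) (F 0) < e"
    by (auto simp: eventually_at_right_field)
  \<comment> \<open>The radius \<open>b / 2\<close> makes up for the doubled step in
    \<open>increment_le\<close>.\<close>
  have *: "F s - F t < e" if "0 \<le> s" "s < t" "t < s + b / 2" for s t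
  proof -
    have "F s - F t \<le> F 0 - F (2 * (t - s))" using increment_le[of s "t - s"] that by simp
    also have "\<dots> < e" using b(2)[of "2 * (t - s)"] that by (simp add: dist_real_def)
    finally show ?thesis .
  qed
  show "\<exists>d>0. \<forall>x'\<in>{0..}. dist x' x < d \<longrightarrow> dist (F x') (F x) \<le> e"
  proof (intro exI[of _ "b / 2"] conjI ballI impI)
    fix y assume y: "y \<in> {0..}" "dist y x < b / 2"
    show "dist (F y) (F x) \<le> e"
      using *[of x y] *[of y x] antimono[of x y] antimono[of y x] x y e
      by (cases x y rule: linorder_cases) (auto simp: dist_real_def)
  qed (use b in auto)
qed

text \<open>Nonnegative second differences give midpoint convexity only; continuity upgrades
  it.\<close>

lemma convex: "0 \<le> a \<Longrightarrow> convex_on {a..b} F"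
  by (rule midpoint_convex_imp_convex_on)
     (use diff2_nonneg in \<open>auto intro: continuous_on_subset[OF continuous] simp: algebra_simps\<close>)

lemma slope_antimono:
  assumes "0 \<le> a" "a < b" "a \<le> c" "b \<le> d" "c < d"
  shows "(F c - F d) / (d - c) \<le> (F a - F b) / (b - a)"
proof -
  note cv = convex[OF assms(1), of d]
  have "(F a - F b) / (a - b) \<le> (F a - F d) / (a - d)"
    using convex_on_slope_le(1)[OF cv, of a d b] assms by (cases "b = d") auto
  moreover have "(F a - F d) / (a - d) \<le> (F c - F d) / (c - d)"
    using convex_on_slope_le(2)[OF cv, of a d c] assms by (cases "a = c") auto
  ultimately have "(F a - F b) / (a - b) \<le> (F c - F d) / (c - d)" by simp
  then have "- ((F c - F d) / (c - d)) \<le> - ((F a - F b) / (a - b))" by simp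
  then show ?thesis
    by (metis minus_diff_eq minus_divide_right)
qed

text \<open>The left side telescopes into \<open>n\<close> second differences, and the first of them
  is the largest.\<close>

lemma increment_diff_le:
  assumes "0 \<le> x" "0 \<le> h"
  shows "(F x - F (x + h)) - (F (x + real n * h) - F (x + real (Suc n) * h)) \<le> real n * diff2 x h"
proof (induction n)
  case (Suc n)
  have "diff2 (x + real n * h) h \<le> diff2 x h"
    unfolding diff2_def using assms by (intro diff2_antimono) auto
  then show ?case using Suc by (simp add: diff2_def algebra_simps)
qed simp

text \<open>In the application \<open>q = r\<^sup>2\<close>, \<open>node s\<close> is twice the squared scale with index \<open>s - 1\<close>, and
  \<open>band s\<close> is the squared norm of the filter response with index \<open>s\<close>.\<close>

context
  fixes q x0 :: real
  assumes q: "1 < q" and x0: "0 < x0"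
begin

definition node :: "int \<Rightarrow> real" where
  "node s = q powi s * x0"

definition band :: "int \<Rightarrow> real" where
  "band s = diff2 (node s) ((q - 1) * node s / 2)"

definition gap :: "int \<Rightarrow> real" where
  "gap s = F (node s) - F (node (s + 1))"

lemma node_pos: "0 < node s"
  using q x0 by (simp add: node_def)

lemma node_Suc: "node (s + 1) = q * node s"
  using q by (simp add: node_def power_int_add)

lemma band_nonneg: "0 \<le> band s"
  unfolding band_def diff2_def using node_pos[of s] q by (intro diff2_nonneg) auto

lemma gap_nonneg: "0 \<le> gap s"
  unfolding gap_def using node_pos[of s] q antimono[of "node s" "node (s + 1)"] by (simp add: node_Suc)

text \<open>One of the two copies of the middle value is traded for the smaller right end
  value.\<close>

lemma band_le_gap: "band s \<le> gap s"
proof -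
  have "F (node s + 2 * ((q - 1) * node s / 2)) \<le> F (node s + (q - 1) * node s / 2)"
    using node_pos[of s] q by (intro antimono) auto
  moreover have "node s + 2 * ((q - 1) * node s / 2) = node (s + 1)"
    unfolding node_Suc by (simp add: field_simps)
  ultimately show ?thesis by (simp add: band_def gap_def diff2_def)
qed

text \<open>The left side is a band length times the difference of the mean rates of decrease over
  the adjacent bands [x, qx] and [qx, qqx], where x is \<open>node (s + 1)\<close>. By convexity the
  first rate is at most the one over a short interval of length \<eta> starting at x, and the second
  is at least the one over such an interval starting beyond qqx. At most \<open>N\<close> second
  differences of step \<eta> separate these two.\<close>

lemma gap_decrease_le: "q * gap (s + 1) - gap (s + 2) \<le> (q - 1) * frame_const q * band s"
proof -
  define N where "N = nat \<lceil>2 * q * (q + 1)\<rceil>"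
  have K: "(q - 1) * frame_const q = 2 * q\<^sup>2 * (real N + 1)"
    using q by (simp add: frame_const_def N_def)
  define \<eta> where "\<eta> = (q - 1) * node s / 2"
  define x where "x = node (s + 1)"
  have n: "node s > 0" by (rule node_pos)
  have \<eta>: "\<eta> > 0" using n q by (simp add: \<eta>_def)
  have x: "x > 0" "x = q * node s" using node_pos[of "s + 1"] by (simp_all add: x_def node_Suc)
  have x2: "node (s + 2) = q * x" and x3: "node (s + 2 + 1) = q * (q * x)"
    using node_Suc[of "s + 1"] node_Suc[of "s + 2"] by (auto simp: x_def add.commute)
  have xq: "q * x = x + (q - 1) * x" "\<eta> \<le> (q - 1) * x"
  proof -
    have "(q - 1) * node s \<le> (q - 1) * (2 * x)"
      using n q x by (intro mult_left_mono) (auto simp: algebra_simps)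
    then show "\<eta> \<le> (q - 1) * x" by (simp add: \<eta>_def)
  qed (simp add: algebra_simps)
  have N: "2 * q * (q + 1) \<le> real N" unfolding N_def by (rule real_nat_ceiling_ge)
  have far: "q * (q * x) \<le> x + real N * \<eta>"
  proof -
    have "2 * q * (q + 1) * \<eta> \<le> real N * \<eta>" using N \<eta> by (intro mult_right_mono) auto
    moreover have "2 * q * (q + 1) * \<eta> = q * (q * x) - x"
      by (simp add: \<eta>_def x field_simps)
    ultimately show ?thesis by simp
  qed
  have qx: "x < q * x" "q * x < q * (q * x)" using q x(1) by auto
  have s1: "(F x - F (q * x)) / (q * x - x) \<le> (F x - F (x + \<eta>)) / \<eta>"
    using slope_antimono[of x "x + \<eta>" x "q * x"] x(1) \<eta> xq qx by simp
  have s2: "(F (x + real N * \<eta>) - F (x + real (Suc N) * \<eta>)) / \<eta>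
      \<le> (F (q * x) - F (q * (q * x))) / (q * (q * x) - q * x)"
  proof -
    have "x + real (Suc N) * \<eta> - (x + real N * \<eta>) = \<eta>" by (simp add: algebra_simps)
    moreover have "q * (q * x) \<le> x + real (Suc N) * \<eta>" using far \<eta> by (simp add: algebra_simps)
    moreover have "0 \<le> q * x" "q * x \<le> x + real N * \<eta>" using q x(1) qx far by (simp, linarith)
    ultimately show ?thesis
      using slope_antimono[of "q * x" "q * (q * x)" "x + real N * \<eta>" "x + real (Suc N) * \<eta>"] \<eta> qx by simp
  qed
  have "(F x - F (q * x)) / (q * x - x) - (F (q * x) - F (q * (q * x))) / (q * (q * x) - q * x)
      \<le> (F x - F (x + \<eta>)) / \<eta> - (F (x + real N * \<eta>) - F (x + real (Suc N) * \<eta>)) / \<eta>"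
    using s1 s2 by simp
  also have "\<dots> = ((F x - F (x + \<eta>)) - (F (x + real N * \<eta>) - F (x + real (Suc N) * \<eta>))) / \<eta>"
    by (simp add: diff_divide_distrib)
  also have "\<dots> \<le> real N * diff2 x \<eta> / \<eta>"
    using increment_diff_le[of x \<eta> N] x(1) \<eta> by (intro divide_right_mono) auto
  also have "\<dots> \<le> (real N + 1) * band s / \<eta>"
  proof -
    \<comment> \<open>Same step \<eta>, but \<open>x\<close> lies to the right of
      \<open>node s\<close>: this is where the third-order condition enters.\<close>
    have "diff2 x \<eta> \<le> band s"
      unfolding band_def diff2_def \<eta>_def[symmetric]
      using n q x \<eta> by (intro diff2_antimono) auto
    then have "real N * diff2 x \<eta> \<le> real N * band s" by (intro mult_left_mono) auto
    also have "\<dots> \<le> (real N + 1) * band s" using band_nonneg[of s] by (simp add: algebra_simps)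
    finally show ?thesis using \<eta> by (intro divide_right_mono) auto
  qed
  finally have le: "(F x - F (q * x)) / (q * x - x) - (F (q * x) - F (q * (q * x))) / (q * (q * x) - q * x)
      \<le> (real N + 1) * band s / \<eta>" .
  have "q * gap (s + 1) - gap (s + 2) = (q * (q * x) - q * x) *
      ((F x - F (q * x)) / (q * x - x) - (F (q * x) - F (q * (q * x))) / (q * (q * x) - q * x))"
  proof -
    have "gap (s + 1) = F x - F (q * x)" "gap (s + 2) = F (q * x) - F (q * (q * x))"
      using x2 x3 by (auto simp: gap_def x_def add.commute)
    moreover define w where "w = q * x - x"
    moreover have "q * (q * x) - q * x = q * w" unfolding w_def by (simp add: algebra_simps)
    moreover have "q * A - B = q * w * (A / w - B / (q * w))" for A B
    proof -
      have "w > 0" using qx(1) unfolding w_def by linarith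
      then show ?thesis using q by (simp add: field_simps)
    qed
    ultimately show ?thesis by (simp only:)
  qed
  also have "\<dots> \<le> (q * (q * x) - q * x) * ((real N + 1) * band s / \<eta>)"
    using le qx by (intro mult_left_mono) auto
  also have "\<dots> = (q - 1) * frame_const q * band s"
    unfolding K using n q by (simp add: \<eta>_def x field_simps power2_eq_square)
  finally show ?thesis .
qed

section \<open>Telescoping over symmetric windows and the two frame bounds\<close>

lemma window_Suc:
  "{- int (Suc n)..<int (Suc n)} = insert (- int (Suc n)) (insert (int n) {- int n..<int n})"
  by auto

lemma sum_gap: "(\<Sum>s\<in>{- int n..<int n}. gap s) = F (node (- int n)) - F (node (int n))"
proof (induction n)
  case (Suc n)
  have "gap (- int (Suc n)) = F (node (- int (Suc n))) - F (node (- int n))"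
    by (simp add: gap_def)
  moreover have "gap (int n) = F (node (int n)) - F (node (int (Suc n)))"
    by (simp add: gap_def add.commute)
  ultimately show ?case
    using Suc unfolding window_Suc by (subst sum.insert; (subst sum.insert)?) auto
qed simp

lemma sum_gap_shift:
  "(\<Sum>s\<in>{- int n..<int n}. gap (s + 1)) = (\<Sum>s\<in>{- int n..<int n}. gap s) + gap (int n) - gap (- int n)"
proof (induction n)
  case (Suc n)
  then show ?case
    unfolding window_Suc by (simp add: add.commute[of "int n" 1])
qed simp

lemma node_tendsto_inf: "filterlim (\<lambda>n. node (int n)) at_top sequentially"
proof -
  have "filterlim (\<lambda>n. q ^ n * x0) at_top sequentially"
    using q x0 filterlim_realpow_sequentially_gt1[of q]
    by (intro filterlim_at_top_mult_tendsto_pos[OF tendsto_const] filterlim_at_infinity_imp_filterlim_at_top) auto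
  then show ?thesis by (simp add: node_def)
qed

lemma node_tendsto_0: "filterlim (\<lambda>n. node (- int n)) (at_right 0) sequentially"
proof -
  have "(\<lambda>n. (1 / q) ^ n * x0) \<longlonglongrightarrow> 0 * x0"
    using q by (intro tendsto_intros LIMSEQ_realpow_zero) auto
  then have "(\<lambda>n. node (- int n)) \<longlonglongrightarrow> 0"
    by (simp add: node_def power_int_minus power_divide divide_inverse power_inverse)
  then show ?thesis
    using node_pos by (auto simp: filterlim_at less_imp_neq[symmetric])
qed

lemma finite_in_window:
  fixes A :: "int set"
  assumes "finite A"
  obtains n where "A \<subseteq> {- int n..<int n}"
proof
  define n where "n = (\<Sum>s\<in>A. nat \<bar>s\<bar>)"
  have "nat \<bar>s\<bar> \<le> n" if "s \<in> A" for s
    unfolding n_def using that assms by (intro member_le_sum) auto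
  \<comment> \<open>The successor makes room for the excluded right end of the window.\<close>
  then show "A \<subseteq> {- int (Suc n)..<int (Suc n)}" by force
qed

text \<open>A bound for all finite sums yields summability and the upper frame constant 1 at
  once.\<close>

lemma sum_band_le:
  assumes "finite A"
  shows "sum band A \<le> F 0"
proof -
  obtain n where n: "A \<subseteq> {- int n..<int n}" using finite_in_window[OF assms] .
  have "sum band A \<le> sum band {- int n..<int n}"
    using n band_nonneg by (intro sum_mono2) auto
  also have "\<dots> \<le> sum gap {- int n..<int n}" by (intro sum_mono band_le_gap)
  also have "\<dots> \<le> F 0"
    using sum_gap[of n] antimono[of 0 "node (- int n)"] nonneg[of "node (int n)"]
      node_pos[of "int n"] node_pos[of "- int n"] by simp
  finally show ?thesis .
qed

lemma band_summable: "band summable_on UNIV"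
  by (rule nonneg_bdd_above_summable_on) (auto intro!: bdd_aboveI[of _ "F 0"] sum_band_le band_nonneg)

lemma infsum_band_le: "infsum band UNIV \<le> F 0"
  by (rule infsum_le_finite_sums[OF band_summable]) (auto intro: sum_band_le)

text \<open>Summing \<open>q * gap s - gap (s + 1)\<close> over a window leaves \<open>q - 1\<close>
  times the sum of the gaps, up to boundary terms. The gaps telescope to a difference of two values
  of \<open>F\<close> that tends to \<open>F 0\<close> as the window grows.\<close>

lemma infsum_band_ge: "F 0 \<le> frame_const q * infsum band UNIV"
proof -
  define K where "K = (q - 1) * frame_const q"
  have K: "K > 0" "\<And>s. q * gap (s + 1) - gap (s + 2) \<le> K * band s"
    using frame_const_pos[OF q] q gap_decrease_le by (auto simp: K_def)
  have *: "(q - 1) * (F (node (- int n)) - F (node (int n))) \<le> K * infsum band UNIV + (F (node (int n)) - F (node (int (Suc n))))"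
    (is "_ * ?d \<le> _ + ?g") for n
  proof -
    have "sum (\<lambda>s. q * gap s - gap (s + 1)) {- int n..<int n} \<le> (\<Sum>s\<in>{- int n..<int n}. K * band (s - 1))"
    proof (rule sum_mono)
      fix s show "q * gap s - gap (s + 1) \<le> K * band (s - 1)" using K(2)[of "s - 1"] by (simp add: add.commute)
    qed
    also have "\<dots> = K * sum band ((\<lambda>s. s - 1) ` {- int n..<int n})"
      by (simp add: sum.reindex sum_distrib_left)
    also have "\<dots> \<le> K * infsum band UNIV"
      using K(1) by (intro mult_left_mono finite_sum_le_infsum band_summable) (auto intro: band_nonneg)
    finally have "q * ?d - (\<Sum>s\<in>{- int n..<int n}. gap (s + 1)) \<le> K * infsum band UNIV"
      by (simp add: sum_subtractf sum_distrib_left[symmetric] sum_gap)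
    \<comment> \<open>Of the two boundary terms, \<open>gap (- int n)\<close> has the favourable
      sign and is dropped; \<open>gap (int n)\<close> is kept and vanishes in the limit.\<close>
    then show ?thesis
      using gap_nonneg[of "- int n"] unfolding sum_gap_shift sum_gap
      by (simp add: gap_def algebra_simps)
  qed
  have Fin: "(\<lambda>n. F (node (int n))) \<longlonglongrightarrow> 0"
    by (rule filterlim_compose[OF tendsto_inf node_tendsto_inf])
  have "(q - 1) * (F 0 - 0) \<le> K * infsum band UNIV + (0 - 0)"
  proof (rule LIMSEQ_le)
    show "(\<lambda>n. (q - 1) * (F (node (- int n)) - F (node (int n)))) \<longlonglongrightarrow> (q - 1) * (F 0 - 0)"
      by (intro tendsto_intros Fin filterlim_compose[OF tendsto_0 node_tendsto_0])
    show "(\<lambda>n. K * infsum band UNIV + (F (node (int n)) - F (node (int (Suc n))))) \<longlonglongrightarrow> K * infsum band UNIV + (0 - 0)"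
      by (intro tendsto_intros Fin LIMSEQ_Suc[OF Fin])
  qed (use * in auto)
  then show ?thesis using q by (simp add: K_def)
qed

end
end

section \<open>Symmetric Markov semigroups\<close>

text \<open>The bound \<open>A t\<close> makes the defining integrals converge at every point, and
  its limit forces decay for large times. Mass and semigroup law are nonnegative integrals, so that
  integrability of the kernels follows from them.\<close>

locale markov_kernel = sigma_finite_measure M for M :: "'a measure" +
  fixes K :: "real \<Rightarrow> 'a \<Rightarrow> 'a \<Rightarrow> real" and A :: "real \<Rightarrow> real"
  assumes K_measurable: "case_prod (K t) \<in> borel_measurable (M \<Otimes>\<^sub>M M)"
    and K_nonneg: "0 \<le> K t x y"
    and K_sym: "K t x y = K t y x"
    and K_mass: "0 < t \<Longrightarrow> x \<in> space M \<Longrightarrow> (\<integral>\<^sup>+ y. ennreal (K t x y) \<partial>M) = 1"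
    and K_semigroup: "0 < s \<Longrightarrow> 0 < t \<Longrightarrow> x \<in> space M \<Longrightarrow> z \<in> space M \<Longrightarrow>
      (\<integral>\<^sup>+ y. ennreal (K s x y * K t y z) \<partial>M) = ennreal (K (s + t) x z)"
    and K_le: "0 < t \<Longrightarrow> x \<in> space M \<Longrightarrow> y \<in> space M \<Longrightarrow> K t x y \<le> A t"
    and A_tendsto: "(A \<longlongrightarrow> 0) at_top"
begin

section \<open>Square-integrable functions and their inner product\<close>

definition L2 :: "('a \<Rightarrow> real) set" where
  "L2 = {f \<in> borel_measurable M. integrable M (\<lambda>x. (f x)\<^sup>2)}"

definition ip :: "('a \<Rightarrow> real) \<Rightarrow> ('a \<Rightarrow> real) \<Rightarrow> real" where
  "ip f g = (\<integral>x. f x * g x \<partial>M)"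

definition nsq :: "('a \<Rightarrow> real) \<Rightarrow> real" where
  "nsq f = (\<integral>x. (f x)\<^sup>2 \<partial>M)"

text \<open>The case split supplies the identity at time 0, where the kernel carries no mass
  condition. With it the semigroup law holds from time 0 on.\<close>

definition T :: "real \<Rightarrow> ('a \<Rightarrow> real) \<Rightarrow> 'a \<Rightarrow> real" where
  "T t f x = (if t = 0 then f x else (\<integral>y. K t x y * f y \<partial>M))"

lemma T_0 [simp]: "T 0 f = f"
  by (simp add: T_def fun_eq_iff)

sublocale pair: pair_sigma_finite M M ..

lemma K_measurable2 [measurable (raw)]:
  assumes "f \<in> N \<rightarrow>\<^sub>M M" "g \<in> N \<rightarrow>\<^sub>M M"
  shows "(\<lambda>x. K t (f x) (g x)) \<in> borel_measurable N"
  using measurable_compose[OF measurable_Pair[OF assms] K_measurable] by simp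

lemma L2D [measurable_dest, dest]: "f \<in> L2 \<Longrightarrow> f \<in> borel_measurable M"
  by (simp add: L2_def)

lemma L2_square_integrable: "f \<in> L2 \<Longrightarrow> integrable M (\<lambda>x. (f x)\<^sup>2)"
  by (simp add: L2_def)

lemma L2_mult_integrable:
  assumes f: "f \<in> L2" and g: "g \<in> L2"
  shows "integrable M (\<lambda>x. f x * g x)"
proof (rule Bochner_Integration.integrable_bound)
  show "integrable M (\<lambda>x. (f x)\<^sup>2 + (g x)\<^sup>2)"
    using f g by (intro Bochner_Integration.integrable_add L2_square_integrable)
  have "\<bar>a * b\<bar> \<le> a\<^sup>2 + b\<^sup>2" for a b :: real
  proof -
    have "2 * (\<bar>a\<bar> * \<bar>b\<bar>) \<le> a\<^sup>2 + b\<^sup>2" using sum_squares_bound[of "\<bar>a\<bar>" "\<bar>b\<bar>"] by (simp add: mult.assoc)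
    moreover have "0 \<le> \<bar>a\<bar> * \<bar>b\<bar>" by simp
    ultimately show ?thesis unfolding abs_mult by linarith
  qed
  then show "AE x in M. norm (f x * g x) \<le> norm ((f x)\<^sup>2 + (g x)\<^sup>2)" by simp
qed (use f g in measurable)

lemma L2_add: "f \<in> L2 \<Longrightarrow> g \<in> L2 \<Longrightarrow> (\<lambda>x. f x + g x) \<in> L2"
  using L2_mult_integrable[of f g]
  by (auto simp: L2_def power2_sum mult.assoc)

lemma L2_cmult: "f \<in> L2 \<Longrightarrow> (\<lambda>x. c * f x) \<in> L2"
  by (auto simp: L2_def power_mult_distrib)

lemma L2_diff: "f \<in> L2 \<Longrightarrow> g \<in> L2 \<Longrightarrow> (\<lambda>x. f x - g x) \<in> L2"
  using L2_add[of f "\<lambda>x. -1 * g x"] L2_cmult[of g "-1"] by simp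

lemma L2_bound:
  assumes "f \<in> L2" "g \<in> borel_measurable M" "\<And>x. x \<in> space M \<Longrightarrow> \<bar>g x\<bar> \<le> \<bar>f x\<bar>"
  shows "g \<in> L2"
  using assms by (auto simp: L2_def abs_le_square_iff intro!: Bochner_Integration.integrable_bound[of M "\<lambda>x. (f x)\<^sup>2" "\<lambda>x. (g x)\<^sup>2"])

lemma L2_abs: "f \<in> L2 \<Longrightarrow> (\<lambda>x. \<bar>f x\<bar>) \<in> L2"
  by (auto simp: L2_def)

lemma nsq_nonneg: "0 \<le> nsq f"
  by (simp add: nsq_def)

lemma ip_self: "ip f f = nsq f"
  by (simp add: ip_def nsq_def power2_eq_square)

lemma nsq_cong: "(\<And>x. x \<in> space M \<Longrightarrow> f x = g x) \<Longrightarrow> nsq f = nsq g"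
  unfolding nsq_def by (rule Bochner_Integration.integral_cong) auto

lemma ip_cong: "(\<And>x. x \<in> space M \<Longrightarrow> f x = f' x) \<Longrightarrow> (\<And>x. x \<in> space M \<Longrightarrow> g x = g' x) \<Longrightarrow> ip f g = ip f' g'"
  unfolding ip_def by (rule Bochner_Integration.integral_cong) auto

lemma nsq_diff: "f \<in> L2 \<Longrightarrow> g \<in> L2 \<Longrightarrow> nsq (\<lambda>x. f x - g x) = nsq f - 2 * ip f g + nsq g"
  using L2_mult_integrable[of f g] L2_square_integrable[of f] L2_square_integrable[of g]
  by (simp add: nsq_def ip_def power2_diff mult.assoc)

text \<open>A stand-in for the triangle inequality that stays with squared norms; its factors 2
  explain the fractions of \<open>e\<close> chosen in the approximation arguments.\<close>

lemma nsq_add_le: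
  assumes f: "f \<in> L2" and g: "g \<in> L2"
  shows "nsq (\<lambda>x. f x + g x) \<le> 2 * nsq f + 2 * nsq g"
proof -
  have *: "(a + b)\<^sup>2 \<le> 2 * a\<^sup>2 + 2 * b\<^sup>2" for a b :: real
    using sum_squares_bound[of a b] by (simp add: power2_sum)
  have "nsq (\<lambda>x. f x + g x) \<le> (\<integral>x. 2 * (f x)\<^sup>2 + 2 * (g x)\<^sup>2 \<partial>M)"
    unfolding nsq_def using f g
    by (intro integral_mono L2_square_integrable L2_add Bochner_Integration.integrable_add integrable_mult_right)
       (simp_all add: *)
  also have "\<dots> = 2 * nsq f + 2 * nsq g"
    using f g by (simp add: nsq_def L2_square_integrable)
  finally show ?thesis .
qed

text \<open>Young's inequality with a free weight, in place of Cauchy-Schwarz; applying it to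
  \<open>f\<close> and to its negative gives the absolute value.\<close>

lemma ip_bound:
  assumes f: "f \<in> L2" and g: "g \<in> L2" and e: "0 < e"
  shows "2 * \<bar>ip f g\<bar> \<le> e * nsq f + nsq g / e"
proof -
  have *: "2 * (a * b) \<le> e * a\<^sup>2 + b\<^sup>2 / e" for a b :: real
  proof -
    have "0 \<le> (e * a - b)\<^sup>2 / e" using e by simp
    also have "\<dots> = e * a\<^sup>2 + b\<^sup>2 / e - 2 * (a * b)"
      using e by (simp add: power2_eq_square field_simps)
    finally show ?thesis by simp
  qed
  have bound: "2 * ip u g \<le> e * nsq u + nsq g / e" if u: "u \<in> L2" for u
  proof -
    have "2 * ip u g = (\<integral>x. 2 * (u x * g x) \<partial>M)" by (simp add: ip_def)
    also have "\<dots> \<le> (\<integral>x. e * (u x)\<^sup>2 + (g x)\<^sup>2 / e \<partial>M)"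
      using u g e by (intro integral_mono integrable_mult_right L2_mult_integrable
        Bochner_Integration.integrable_add integrable_divide L2_square_integrable *) auto
    also have "\<dots> = e * nsq u + nsq g / e"
      using u g by (simp add: nsq_def L2_square_integrable)
    finally show ?thesis .
  qed
  have "ip (\<lambda>x. -1 * f x) g = - ip f g" "nsq (\<lambda>x. -1 * f x) = nsq f"
    by (simp_all add: ip_def nsq_def)
  with bound[OF f] bound[OF L2_cmult[OF f, of "-1"]] show ?thesis by (simp add: abs_if)
qed

section \<open>The operators: contraction, symmetry and semigroup law\<close>

lemma K_integrable: "0 < t \<Longrightarrow> x \<in> space M \<Longrightarrow> integrable M (K t x)"
  by (rule integrableI_nonneg) (auto simp: K_nonneg K_mass)

lemma K_integral: "0 < t \<Longrightarrow> x \<in> space M \<Longrightarrow> (\<integral>y. K t x y \<partial>M) = 1"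
  by (subst integral_eq_nn_integral) (auto simp: K_nonneg K_mass)

lemma K_square_integrable:
  assumes "f \<in> L2" "0 < t" "x \<in> space M"
  shows "integrable M (\<lambda>y. K t x y * (f y)\<^sup>2)"
proof (rule Bochner_Integration.integrable_bound)
  show "integrable M (\<lambda>y. A t * (f y)\<^sup>2)"
    using assms by (intro integrable_mult_right L2_square_integrable)
  show "AE y in M. norm (K t x y * (f y)\<^sup>2) \<le> norm (A t * (f y)\<^sup>2)"
  proof (rule AE_I2)
    fix y assume "y \<in> space M"
    then have "\<bar>K t x y\<bar> \<le> \<bar>A t\<bar>" using K_le[OF assms(2,3), of y] K_nonneg[of t x y] by simp
    then show "norm (K t x y * (f y)\<^sup>2) \<le> norm (A t * (f y)\<^sup>2)"
      by (simp add: abs_mult mult_right_mono)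
  qed
qed (use assms in measurable)

text \<open>Since |a| <= 1 + a^2, the mass of the kernel and its boundedness suffice. Integrability
  at every \<open>x\<close>, not just almost every one, allows the later identities to be pointwise
  ones.\<close>

lemma K_mult_integrable:
  assumes "f \<in> L2" "0 < t" "x \<in> space M"
  shows "integrable M (\<lambda>y. K t x y * f y)"
proof (rule Bochner_Integration.integrable_bound)
  show "integrable M (\<lambda>y. K t x y + K t x y * (f y)\<^sup>2)"
    using assms by (intro Bochner_Integration.integrable_add K_square_integrable K_integrable)
  have "\<bar>k * a\<bar> \<le> \<bar>k + k * a\<^sup>2\<bar>" if "0 \<le> k" for k a :: real
  proof -
    have "\<bar>a\<bar> \<le> 1 + a\<^sup>2"
      using sum_squares_bound[of 1 "\<bar>a\<bar>"] by simp
    then have "k * \<bar>a\<bar> \<le> k * (1 + a\<^sup>2)" using that by (rule mult_left_mono)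
    then show ?thesis using that by (simp add: abs_mult algebra_simps)
  qed
  then show "AE y in M. norm (K t x y * f y) \<le> norm (K t x y + K t x y * (f y)\<^sup>2)"
    using K_nonneg by simp
qed (use assms in measurable)

lemma T_measurable [measurable]:
  assumes [measurable]: "f \<in> borel_measurable M"
  shows "T t f \<in> borel_measurable M"
  unfolding T_def by measurable

text \<open>Jensen's inequality for the probability density \<open>K t x\<close>, as nonnegativity of a variance.\<close>

lemma T_square_le:
  assumes "f \<in> L2" "0 < t" "x \<in> space M"
  shows "(T t f x)\<^sup>2 \<le> (\<integral>y. K t x y * (f y)\<^sup>2 \<partial>M)"
proof -
  define m where "m = T t f x"
  have int: "integrable M (\<lambda>y. K t x y * (f y)\<^sup>2)" "integrable M (\<lambda>y. K t x y * f y)" "integrable M (K t x)"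
    using assms by (auto intro: K_square_integrable K_mult_integrable K_integrable)
  have "0 \<le> (\<integral>y. K t x y * (f y - m)\<^sup>2 \<partial>M)"
    using K_nonneg by (intro integral_nonneg_AE) auto
  also have "\<dots> = (\<integral>y. K t x y * (f y)\<^sup>2 - 2 * m * (K t x y * f y) + m\<^sup>2 * K t x y \<partial>M)"
    by (intro Bochner_Integration.integral_cong) (auto simp: power2_diff algebra_simps)
  also have "\<dots> = (\<integral>y. K t x y * (f y)\<^sup>2 \<partial>M) - 2 * m * (\<integral>y. K t x y * f y \<partial>M) + m\<^sup>2 * 1"
    using int K_integral[OF assms(2,3)] by simp
  also have "(\<integral>y. K t x y * f y \<partial>M) = m" using assms by (simp add: m_def T_def)
  finally show ?thesis by (simp add: m_def power2_eq_square)
qed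

text \<open>Integrate Jensen's inequality over \<open>x\<close> and exchange the integrals; by
  symmetry the kernel also has mass 1 in its first variable. The nonnegative integral is essential
  here, as the bound has to prove that the square of \<open>T t f\<close> is integrable.\<close>

lemma T_nn_integral_le:
  assumes f: "f \<in> L2" and t: "0 < t"
  shows "(\<integral>\<^sup>+x. ennreal ((T t f x)\<^sup>2) \<partial>M) \<le> ennreal (nsq f)"
proof -
  note [measurable] = L2D[OF f]
  have "(\<integral>\<^sup>+x. ennreal ((T t f x)\<^sup>2) \<partial>M) \<le> (\<integral>\<^sup>+x. (\<integral>\<^sup>+y. ennreal (K t x y * (f y)\<^sup>2) \<partial>M) \<partial>M)"
  proof (rule nn_integral_mono)
    fix x assume x: "x \<in> space M"
    show "ennreal ((T t f x)\<^sup>2) \<le> (\<integral>\<^sup>+y. ennreal (K t x y * (f y)\<^sup>2) \<partial>M)"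
      using T_square_le[OF f t x] K_square_integrable[OF f t x] K_nonneg
      by (subst nn_integral_eq_integral) (auto intro: ennreal_leI)
  qed
  also have "\<dots> = (\<integral>\<^sup>+y. (\<integral>\<^sup>+x. ennreal (K t x y * (f y)\<^sup>2) \<partial>M) \<partial>M)"
    by (rule pair.Fubini'[symmetric]) measurable
  also have "\<dots> = (\<integral>\<^sup>+y. ennreal ((f y)\<^sup>2) \<partial>M)"
  proof (rule nn_integral_cong)
    fix y assume y: "y \<in> space M"
    have "(\<integral>\<^sup>+x. ennreal (K t x y * (f y)\<^sup>2) \<partial>M) = (\<integral>\<^sup>+x. ennreal (K t y x) * ennreal ((f y)\<^sup>2) \<partial>M)"
      by (simp add: K_sym[of t _ y] ennreal_mult' K_nonneg)
    also have "\<dots> = ennreal ((f y)\<^sup>2)"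
      using y t by (subst nn_integral_multc) (auto simp: K_mass)
    finally show "(\<integral>\<^sup>+x. ennreal (K t x y * (f y)\<^sup>2) \<partial>M) = ennreal ((f y)\<^sup>2)" .
  qed
  also have "\<dots> = ennreal (nsq f)"
    unfolding nsq_def using L2_square_integrable[OF f] by (intro nn_integral_eq_integral) auto
  finally show ?thesis .
qed

lemma T_L2: 
  assumes f: "f \<in> L2" and t: "0 \<le> t"
  shows "T t f \<in> L2"
proof (cases "t = 0")
  case False
  then have t: "0 < t" using t by simp
  have "integrable M (\<lambda>x. (T t f x)\<^sup>2)"
    using f le_less_trans[OF T_nn_integral_le[OF f t] ennreal_less_top]
    by (intro integrableI_nonneg) auto
  then show ?thesis using f by (auto simp: L2_def)
qed (use f in simp)

lemma nsq_T_le: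
  assumes f: "f \<in> L2" and t: "0 \<le> t"
  shows "nsq (T t f) \<le> nsq f"
proof (cases "t = 0")
  case False
  then have t: "0 < t" using t by simp
  have "ennreal (nsq (T t f)) = (\<integral>\<^sup>+x. ennreal ((T t f x)\<^sup>2) \<partial>M)"
    unfolding nsq_def using L2_square_integrable[OF T_L2[OF f]] t
    by (intro nn_integral_eq_integral[symmetric]) auto
  also have "\<dots> \<le> ennreal (nsq f)" by (rule T_nn_integral_le[OF f t])
  finally show ?thesis by (simp add: nsq_nonneg)
qed simp

lemma T_add:
  assumes "f \<in> L2" "g \<in> L2" "0 \<le> t" "x \<in> space M"
  shows "T t (\<lambda>x. f x + g x) x = T t f x + T t g x"
  using assms K_mult_integrable[of f t x] K_mult_integrable[of g t x]
  by (auto simp: T_def distrib_left)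

lemma T_cmult: "T t (\<lambda>x. c * f x) x = c * T t f x"
  by (simp add: T_def mult.left_commute)

lemma T_diff:
  assumes "f \<in> L2" "g \<in> L2" "0 \<le> t" "x \<in> space M"
  shows "T t (\<lambda>x. f x - g x) x = T t f x - T t g x"
  using assms K_mult_integrable[of f t x] K_mult_integrable[of g t x]
  by (auto simp: T_def right_diff_distrib)

lemma T_symmetric:
  assumes f: "f \<in> L2" and g: "g \<in> L2" and t: "0 \<le> t"
  shows "ip (T t f) g = ip f (T t g)"
proof (cases "t = 0")
  case False
  then have t: "0 < t" using t by simp
  note [measurable] = L2D[OF f] L2D[OF g]
  have int: "integrable (M \<Otimes>\<^sub>M M) (\<lambda>(x, y). K t x y * f y * g x)"
  proof (rule pair.Fubini_integrable)
    \<comment> \<open>Integrating the absolute value over \<open>y\<close> gives a product of two L2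
      functions, which is integrable.\<close>
    have "(\<lambda>x. \<integral>y. norm (case (x, y) of (x, y) \<Rightarrow> K t x y * f y * g x) \<partial>M) = (\<lambda>x. T t (\<lambda>y. \<bar>f y\<bar>) x * \<bar>g x\<bar>)"
      using t K_nonneg by (simp add: abs_mult T_def fun_eq_iff)
    then show "integrable M (\<lambda>x. \<integral>y. norm (case (x, y) of (x, y) \<Rightarrow> K t x y * f y * g x) \<partial>M)"
      using L2_mult_integrable[OF T_L2[OF L2_abs[OF f]] L2_abs[OF g]] t by simp
    show "AE x in M. integrable M (\<lambda>y. case (x, y) of (x, y) \<Rightarrow> K t x y * f y * g x)"
      using K_mult_integrable[OF f t] by auto
  qed measurable
  have "ip (T t f) g = (\<integral>x. (\<integral>y. K t x y * f y * g x \<partial>M) \<partial>M)"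
    using t by (simp add: ip_def T_def)
  also have "\<dots> = (\<integral>y. (\<integral>x. K t x y * f y * g x \<partial>M) \<partial>M)"
    using pair.Fubini_integral[OF int] by simp
  also have "\<dots> = (\<integral>y. f y * (\<integral>x. K t y x * g x \<partial>M) \<partial>M)"
    by (simp add: K_sym[of t _ "_ :: 'a"] flip: integral_mult_right_zero) (simp add: ac_simps K_sym)
  also have "\<dots> = ip f (T t g)"
    using t by (simp add: ip_def T_def)
  finally show ?thesis .
qed simp

lemma T_T:
  assumes f: "f \<in> L2" and s: "0 \<le> s" and t: "0 \<le> t" and x: "x \<in> space M"
  shows "T s (T t f) x = T (s + t) f x"
proof (cases "s = 0 \<or> t = 0")
  case False
  then have s: "0 < s" and t: "0 < t" using s t by auto
  note [measurable] = L2D[OF f] x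
  have int: "integrable (M \<Otimes>\<^sub>M M) (\<lambda>(y, z). K s x y * (K t y z * f z))"
  proof (rule pair.Fubini_integrable)
    have "(\<lambda>y. \<integral>z. norm (case (y, z) of (y, z) \<Rightarrow> K s x y * (K t y z * f z)) \<partial>M) = (\<lambda>y. K s x y * T t (\<lambda>y. \<bar>f y\<bar>) y)"
      using t K_nonneg by (simp add: abs_mult T_def fun_eq_iff)
    then show "integrable M (\<lambda>y. \<integral>z. norm (case (y, z) of (y, z) \<Rightarrow> K s x y * (K t y z * f z)) \<partial>M)"
      using K_mult_integrable[OF T_L2[OF L2_abs[OF f]] s x] t by simp
    show "AE y in M. integrable M (\<lambda>z. case (y, z) of (y, z) \<Rightarrow> K s x y * (K t y z * f z))"
      using K_mult_integrable[OF f t] by auto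
  qed measurable
  have "T s (T t f) x = (\<integral>y. (\<integral>z. K s x y * (K t y z * f z) \<partial>M) \<partial>M)"
    using s t by (simp add: T_def)
  also have "\<dots> = (\<integral>z. (\<integral>y. K s x y * (K t y z * f z) \<partial>M) \<partial>M)"
    using pair.Fubini_integral[OF int] by simp
  also have "\<dots> = (\<integral>z. K (s + t) x z * f z \<partial>M)"
  proof (rule Bochner_Integration.integral_cong)
    fix z assume z: "z \<in> space M"
    have "(\<integral>y. K s x y * K t y z \<partial>M) = K (s + t) x z"
      using z x K_nonneg K_semigroup[OF s t x z] by (subst integral_eq_nn_integral) auto
    moreover have "(\<integral>y. K s x y * (K t y z * f z) \<partial>M) = (\<integral>y. K s x y * K t y z \<partial>M) * f z"
      by (simp flip: mult.assoc)
    ultimately show "(\<integral>y. K s x y * (K t y z * f z) \<partial>M) = K (s + t) x z * f z" by simp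
  qed simp
  also have "\<dots> = T (s + t) f x" using s t by (simp add: T_def)
  finally show ?thesis .
qed auto

lemma ip_T_T:
  assumes f: "f \<in> L2" and s: "0 \<le> s" and t: "0 \<le> t"
  shows "ip (T s f) (T t f) = ip f (T (s + t) f)"
proof -
  have "ip (T s f) (T t f) = ip f (T s (T t f))"
    using assms by (intro T_symmetric T_L2)
  also have "\<dots> = ip f (T (s + t) f)"
    using assms by (intro ip_cong T_T) auto
  finally show ?thesis .
qed

section \<open>The energy and its finite differences\<close>

definition energy :: "('a \<Rightarrow> real) \<Rightarrow> real \<Rightarrow> real" where
  "energy f t = ip f (T t f)"

lemma energy_0: "energy f 0 = nsq f"
  by (simp add: energy_def ip_self)

lemma nsq_T: "f \<in> L2 \<Longrightarrow> 0 \<le> t \<Longrightarrow> nsq (T t f) = energy f (2 * t)"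
  using ip_T_T[of f t t] by (simp add: energy_def ip_self)

lemma nsq_T_diff:
  "f \<in> L2 \<Longrightarrow> 0 \<le> s \<Longrightarrow> 0 \<le> t \<Longrightarrow>
    nsq (\<lambda>x. T s f x - T t f x) = energy f (2 * s) - 2 * energy f (s + t) + energy f (2 * t)"
  by (simp add: nsq_diff T_L2 nsq_T ip_T_T energy_def)

text \<open>Every second difference of the energy is a squared norm, at half the base point because
  \<open>energy f (2 * t)\<close> is the squared norm of \<open>T t f\<close>.\<close>

lemma energy_diff2:
  "f \<in> L2 \<Longrightarrow> 0 \<le> t \<Longrightarrow> 0 \<le> h \<Longrightarrow>
    energy f t - 2 * energy f (t + h) + energy f (t + 2 * h) = nsq (\<lambda>x. T (t / 2) f x - T (t / 2 + h) f x)"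
  by (subst nsq_T_diff) (auto simp: algebra_simps)

lemma energy_antimono:
  assumes f: "f \<in> L2" and s: "0 \<le> s" "s \<le> t"
  shows "energy f t \<le> energy f s"
proof -
  have "energy f t = nsq (T (t / 2) f)" using assms by (simp add: nsq_T)
  also have "\<dots> = nsq (T ((t - s) / 2) (T (s / 2) f))"
    using assms by (intro nsq_cong) (simp add: T_T field_simps)
  also have "\<dots> \<le> nsq (T (s / 2) f)" using assms by (intro nsq_T_le T_L2) auto
  also have "\<dots> = energy f s" using assms by (simp add: nsq_T)
  finally show ?thesis .
qed

text \<open>The difference whose norm is taken at \<open>t\<close> is the image under
  \<open>T ((t - s) / 2)\<close> of the one at \<open>s\<close>, so contraction gives the
  claim.\<close>

lemma energy_diff2_antimono:
  assumes f: "f \<in> L2" and s: "0 \<le> s" "s \<le> t" and h: "0 \<le> h"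
  shows "energy f t - 2 * energy f (t + h) + energy f (t + 2 * h)
    \<le> energy f s - 2 * energy f (s + h) + energy f (s + 2 * h)"
proof -
  let ?u = "\<lambda>x. T (s / 2) f x - T (s / 2 + h) f x"
  have u: "?u \<in> L2" using assms by (intro L2_diff T_L2) auto
  have "T (t / 2) f x - T (t / 2 + h) f x = T ((t - s) / 2) ?u x" if x: "x \<in> space M" for x
  proof -
    have "T ((t - s) / 2) ?u x = T ((t - s) / 2) (T (s / 2) f) x - T ((t - s) / 2) (T (s / 2 + h) f) x"
      using assms x by (intro T_diff T_L2) auto
    moreover have "(t - s) / 2 + s / 2 = t / 2" "(t - s) / 2 + (s / 2 + h) = t / 2 + h"
      by (simp_all add: field_simps)
    ultimately show ?thesis using assms x by (simp add: T_T)
  qed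
  then have "nsq (\<lambda>x. T (t / 2) f x - T (t / 2 + h) f x) = nsq (T ((t - s) / 2) ?u)"
    by (rule nsq_cong)
  also have "\<dots> \<le> nsq ?u" using assms u by (intro nsq_T_le) auto
  finally show ?thesis using assms by (simp add: energy_diff2)
qed

lemma nsq_swap: "nsq (\<lambda>x. f x - g x) = nsq (\<lambda>x. g x - f x)"
  by (simp add: nsq_def power2_commute)

lemma nsq_tendsto_0:
  assumes f: "f \<in> L2" and g: "\<And>n. g n \<in> borel_measurable M"
    and le: "\<And>n x. x \<in> space M \<Longrightarrow> \<bar>g n x\<bar> \<le> \<bar>f x\<bar>"
    and lim: "\<And>x. x \<in> space M \<Longrightarrow> (\<lambda>n. g n x) \<longlonglongrightarrow> f x"
  shows "(\<lambda>n::nat. nsq (\<lambda>x. f x - g n x)) \<longlonglongrightarrow> 0"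
proof -
  note [measurable] = L2D[OF f] g
  have "(\<lambda>n. \<integral>x. (f x - g n x)\<^sup>2 \<partial>M) \<longlonglongrightarrow> (\<integral>x. 0 \<partial>M)"
  proof (rule integral_dominated_convergence)
    show "integrable M (\<lambda>x. (2 * f x)\<^sup>2)" by (intro L2_square_integrable L2_cmult f)
    show "AE x in M. (\<lambda>n. (f x - g n x)\<^sup>2) \<longlonglongrightarrow> 0"
    proof (rule AE_I2)
      fix x assume "x \<in> space M"
      from tendsto_power[OF tendsto_diff[OF tendsto_const lim[OF this]], of "f x" 2]
      show "(\<lambda>n. (f x - g n x)\<^sup>2) \<longlonglongrightarrow> 0" by simp
    qed
    show "AE x in M. norm ((f x - g n x)\<^sup>2) \<le> (2 * f x)\<^sup>2" for n
    proof (rule AE_I2)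
      fix x assume "x \<in> space M"
      from le[OF this, of n] have "\<bar>f x - g n x\<bar> \<le> \<bar>2 * f x\<bar>" by auto
      then show "norm ((f x - g n x)\<^sup>2) \<le> (2 * f x)\<^sup>2" by (simp only: norm_power real_norm_def power_abs[symmetric] abs_power2 abs_le_square_iff)
    qed
  qed measurable
  then show ?thesis by (simp add: nsq_def)
qed

lemma L2_restrict: "f \<in> L2 \<Longrightarrow> S \<in> sets M \<Longrightarrow> (\<lambda>x. f x * indicator S x) \<in> L2"
  by (rule L2_bound) (auto simp: abs_mult indicator_def)

lemma L2_indicator: "S \<in> sets M \<Longrightarrow> emeasure M S < \<infinity> \<Longrightarrow> indicator S \<in> L2"
  by (auto simp: L2_def power2_eq_square simp flip: indicator_inter_arith)

subsection \<open>Decay of the energy\<close>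

text \<open>By symmetry the squared norm is the pairing of \<open>g\<close> with
  \<open>T (2 * t) g\<close>, and the kernel bound controls the second factor uniformly by the L1
  norm of \<open>g\<close>.\<close>

lemma nsq_T_le_L1:
  assumes g: "g \<in> L2" "integrable M g" and t: "0 < t"
  shows "nsq (T t g) \<le> A (2 * t) * (\<integral>x. \<bar>g x\<bar> \<partial>M)\<^sup>2"
proof -
  let ?I = "\<integral>x. \<bar>g x\<bar> \<partial>M"
  have *: "\<bar>T (2 * t) g x\<bar> \<le> A (2 * t) * ?I" if x: "x \<in> space M" for x
  proof -
    have "\<bar>T (2 * t) g x\<bar> \<le> (\<integral>y. \<bar>K (2 * t) x y * g y\<bar> \<partial>M)"
      using t by (simp add: T_def)
    also have "\<dots> \<le> (\<integral>y. A (2 * t) * \<bar>g y\<bar> \<partial>M)"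
      using g t x K_le[of "2 * t" x] K_nonneg
      by (intro integral_mono integrable_abs K_mult_integrable integrable_mult_right) (auto simp: abs_mult intro!: mult_right_mono)
    finally show ?thesis by simp
  qed
  have "nsq (T t g) = (\<integral>x. g x * T (2 * t) g x \<partial>M)"
    using g t by (simp add: nsq_T energy_def ip_def)
  also have "\<dots> \<le> (\<integral>x. \<bar>g x\<bar> * (A (2 * t) * ?I) \<partial>M)"
  proof (intro integral_mono integrable_mult_left integrable_abs g)
    show "integrable M (\<lambda>x. g x * T (2 * t) g x)" using g t by (intro L2_mult_integrable T_L2) auto
    fix x assume "x \<in> space M"
    have "g x * T (2 * t) g x \<le> \<bar>g x\<bar> * \<bar>T (2 * t) g x\<bar>" by (simp flip: abs_mult)
    also have "\<dots> \<le> \<bar>g x\<bar> * (A (2 * t) * ?I)" using *[OF \<open>x \<in> space M\<close>] by (rule mult_left_mono) simp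
    finally show "g x * T (2 * t) g x \<le> \<bar>g x\<bar> * (A (2 * t) * ?I)" .
  qed
  also have "\<dots> = A (2 * t) * ?I\<^sup>2" by (simp add: power2_eq_square)
  finally show ?thesis .
qed

lemma L2_L1_approx:
  assumes f: "f \<in> L2" and e: "0 < e"
  obtains g where "g \<in> L2" "integrable M g" "nsq (\<lambda>x. f x - g x) < e"
proof -
  obtain S :: "nat \<Rightarrow> 'a set" where S: "range S \<subseteq> sets M" "(\<Union>i. S i) = space M" "\<And>i. emeasure M (S i) \<noteq> \<infinity>" "incseq S"
    using sigma_finite_incseq by blast
  define g where "g n x = f x * indicator (S n) x" for n x
  have [measurable]: "S n \<in> sets M" for n using S(1) by auto
  have L: "g n \<in> L2" for n unfolding g_def by (rule L2_restrict[OF f]) simp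
  have "(\<lambda>n. nsq (\<lambda>x. f x - g n x)) \<longlonglongrightarrow> 0"
  proof (rule nsq_tendsto_0[OF f])
    fix x assume "x \<in> space M"
    then have "(\<lambda>n. indicator (S n) x :: real) \<longlonglongrightarrow> indicator (space M) x"
      using LIMSEQ_indicator_incseq[OF S(4), of x] S(2) by simp
    from tendsto_mult[OF tendsto_const this, of "f x"] \<open>x \<in> space M\<close>
    show "(\<lambda>n. g n x) \<longlonglongrightarrow> f x" by (simp add: g_def)
  next
    show "g n \<in> borel_measurable M" for n by (rule L2D[OF L])
  qed (auto simp: g_def abs_mult indicator_def)
  from order_tendstoD(2)[OF this e] obtain n where "nsq (\<lambda>x. f x - g n x) < e"
    by (auto simp: eventually_sequentially)
  moreover have "integrable M (g n)"
    unfolding g_def using S(3)[of n] by (intro L2_mult_integrable L2_indicator f) (auto simp: less_top)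
  ultimately show ?thesis using that[OF L] by blast
qed

lemma energy_tendsto_inf:
  assumes f: "f \<in> L2"
  shows "(energy f \<longlongrightarrow> 0) at_top"
proof (rule tendstoI)
  fix e :: real assume e: "0 < e"
  \<comment> \<open>The part \<open>f - g\<close> stays small by contraction, and \<open>g\<close>
    decays by its L1 bound. Each squared norm enters with a factor 2, hence the quarter.\<close>
  obtain g where g: "g \<in> L2" "integrable M g" "nsq (\<lambda>x. f x - g x) < e / 4"
    using L2_L1_approx[OF f, of "e / 4"] e by auto
  have "((\<lambda>t. A t * (\<integral>x. \<bar>g x\<bar> \<partial>M)\<^sup>2) \<longlongrightarrow> 0 * (\<integral>x. \<bar>g x\<bar> \<partial>M)\<^sup>2) at_top"
    by (intro tendsto_mult A_tendsto tendsto_const)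
  then have "\<forall>\<^sub>F t in at_top. A t * (\<integral>x. \<bar>g x\<bar> \<partial>M)\<^sup>2 < e / 4"
    using e by (intro order_tendstoD(2)) auto
  then show "\<forall>\<^sub>F t in at_top. dist (energy f t) 0 < e"
    using eventually_gt_at_top[of 0]
  proof eventually_elim
    case (elim t)
    have fg: "(\<lambda>x. f x - g x) \<in> L2" by (intro L2_diff f g)
    have "energy f t = nsq (T (t / 2) f)" using f elim by (simp add: nsq_T)
    also have "\<dots> = nsq (\<lambda>x. T (t / 2) (\<lambda>x. f x - g x) x + T (t / 2) g x)"
      using elim f g by (intro nsq_cong) (simp add: T_diff)
    also have "\<dots> \<le> 2 * nsq (T (t / 2) (\<lambda>x. f x - g x)) + 2 * nsq (T (t / 2) g)"
      using elim g fg by (intro nsq_add_le T_L2) auto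
    also have "\<dots> \<le> 2 * nsq (\<lambda>x. f x - g x) + 2 * (A t * (\<integral>x. \<bar>g x\<bar> \<partial>M)\<^sup>2)"
      using nsq_T_le[OF fg, of "t / 2"] nsq_T_le_L1[OF g(1,2), of "t / 2"] elim by simp
    also have "\<dots> < e" using elim g by simp
    finally have "energy f t < e" .
    moreover have "0 \<le> energy f t" using f elim nsq_T[OF f, of "t / 2"] nsq_nonneg[of "T (t / 2) f"] by simp
    ultimately show ?case by simp
  qed
qed

subsection \<open>Strong continuity\<close>

text \<open>Membership in L2 is included so that the predicate describes a closed linear subspace,
  as the closure lemmas below show.\<close>

definition cont_at_0 :: "('a \<Rightarrow> real) \<Rightarrow> bool" where
  "cont_at_0 f \<longleftrightarrow> f \<in> L2 \<and> ((\<lambda>t. nsq (\<lambda>x. T t f x - f x)) \<longlongrightarrow> 0) (at_right 0)"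

lemma cont_at_0_L2: "cont_at_0 f \<Longrightarrow> f \<in> L2"
  by (simp add: cont_at_0_def)

lemma pos_at_right_0: "\<forall>\<^sub>F t in at_right (0::real). 0 < t"
  by (simp add: eventually_at_right_less)

lemma cont_at_0_imp_energy:
  assumes "cont_at_0 f"
  shows "(energy f \<longlongrightarrow> energy f 0) (at_right 0)"
proof (rule tendstoI)
  fix d :: real assume d: "0 < d"
  have f: "f \<in> L2" using assms by (rule cont_at_0_L2)
  \<comment> \<open>The added 1 covers \<open>nsq f = 0\<close> and makes
    \<open>e * nsq f < d\<close> strict.\<close>
  define e where "e = d / (nsq f + 1)"
  have e: "0 < e" "e * nsq f < d"
    using d nsq_nonneg[of f] by (auto simp: e_def field_simps)
  have "\<forall>\<^sub>F t in at_right 0. nsq (\<lambda>x. T t f x - f x) < e * d"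
    using assms e d by (intro order_tendstoD(2)[of _ 0]) (auto simp: cont_at_0_def)
  then show "\<forall>\<^sub>F t in at_right 0. dist (energy f t) (energy f 0) < d"
    using pos_at_right_0
  proof eventually_elim
    case (elim t)
    have L: "T t f \<in> L2" using f elim by (intro T_L2) auto
    have "energy f t - energy f 0 = ip f (\<lambda>x. T t f x - f x)"
      using f L by (simp add: energy_def ip_def L2_mult_integrable right_diff_distrib)
    then have "2 * \<bar>energy f t - energy f 0\<bar> \<le> e * nsq f + nsq (\<lambda>x. T t f x - f x) / e"
      using ip_bound[OF f L2_diff[OF L f] e(1)] by simp
    also have "nsq (\<lambda>x. T t f x - f x) / e < d" using elim e by (simp add: field_simps)
    finally show ?case using e by (simp add: dist_real_def)
  qed
qed

text \<open>The squared norm of \<open>T t f - f\<close> is F(2t) - 2F(t) + F(0), so a scalar limit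
  decides strong continuity. The scalar form is the one that factors on boxes.\<close>

lemma energy_imp_cont_at_0:
  assumes f: "f \<in> L2" and lim: "(energy f \<longlongrightarrow> nsq f) (at_right 0)"
  shows "cont_at_0 f"
proof -
  have "filterlim (\<lambda>t::real. 2 * t) (at_right 0) (at_right 0)"
    unfolding filterlim_at
  proof
    show "\<forall>\<^sub>F t::real in at_right 0. 2 * t \<in> {0<..} \<and> 2 * t \<noteq> 0"
      using pos_at_right_0 by eventually_elim auto
    show "((\<lambda>t::real. 2 * t) \<longlongrightarrow> 0) (at_right 0)"
      by (auto intro!: tendsto_eq_intros)
  qed
  note filterlim_compose[OF lim this]
  then have "((\<lambda>t. energy f (2 * t) - 2 * energy f t + nsq f) \<longlongrightarrow> nsq f - 2 * nsq f + nsq f) (at_right 0)"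
    by (intro tendsto_intros lim)
  moreover have "\<forall>\<^sub>F t in at_right 0. energy f (2 * t) - 2 * energy f t + nsq f = nsq (\<lambda>x. T t f x - f x)"
    using pos_at_right_0
  proof eventually_elim
    case (elim t)
    then show ?case using nsq_T_diff[OF f, of t 0] by (simp add: energy_0)
  qed
  ultimately have "((\<lambda>t. nsq (\<lambda>x. T t f x - f x)) \<longlongrightarrow> 0) (at_right 0)"
    by (auto elim: Lim_transform_eventually)
  then show ?thesis using f by (simp add: cont_at_0_def)
qed

lemma cont_at_0_cmult:
  assumes "cont_at_0 f"
  shows "cont_at_0 (\<lambda>x. c * f x)"
proof -
  have "nsq (\<lambda>x. T t (\<lambda>x. c * f x) x - c * f x) = c\<^sup>2 * nsq (\<lambda>x. T t f x - f x)" for t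
    by (simp add: T_cmult nsq_def power_mult_distrib flip: right_diff_distrib)
  moreover have "((\<lambda>t. c\<^sup>2 * nsq (\<lambda>x. T t f x - f x)) \<longlongrightarrow> c\<^sup>2 * 0) (at_right 0)"
    using assms by (intro tendsto_intros) (simp add: cont_at_0_def)
  ultimately show ?thesis using assms by (simp add: cont_at_0_def L2_cmult)
qed

lemma cont_at_0_add:
  assumes f: "cont_at_0 f" and g: "cont_at_0 g"
  shows "cont_at_0 (\<lambda>x. f x + g x)"
proof -
  note L = cont_at_0_L2[OF f] cont_at_0_L2[OF g]
  have lim: "((\<lambda>t. 2 * nsq (\<lambda>x. T t f x - f x) + 2 * nsq (\<lambda>x. T t g x - g x)) \<longlongrightarrow> 0) (at_right 0)"
    using f g by (auto intro!: tendsto_eq_intros simp: cont_at_0_def)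
  have "\<forall>\<^sub>F t in at_right 0. norm (nsq (\<lambda>x. T t (\<lambda>x. f x + g x) x - (f x + g x)))
      \<le> 2 * nsq (\<lambda>x. T t f x - f x) + 2 * nsq (\<lambda>x. T t g x - g x)"
    using pos_at_right_0
  proof eventually_elim
    case (elim t)
    have "nsq (\<lambda>x. T t (\<lambda>x. f x + g x) x - (f x + g x)) = nsq (\<lambda>x. (T t f x - f x) + (T t g x - g x))"
      using L elim by (intro nsq_cong) (simp add: T_add)
    also have "\<dots> \<le> 2 * nsq (\<lambda>x. T t f x - f x) + 2 * nsq (\<lambda>x. T t g x - g x)"
      using L elim by (intro nsq_add_le L2_diff T_L2) auto
    finally show ?case by (simp add: nsq_nonneg)
  qed
  from Lim_null_comparison[OF this lim] have "((\<lambda>t. nsq (\<lambda>x. T t (\<lambda>x. f x + g x) x - (f x + g x))) \<longlongrightarrow> 0) (at_right 0)"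
    .
  then show ?thesis using L by (simp add: cont_at_0_def L2_add)
qed

lemma cont_at_0_diff: "cont_at_0 f \<Longrightarrow> cont_at_0 g \<Longrightarrow> cont_at_0 (\<lambda>x. f x - g x)"
  using cont_at_0_add[of f "\<lambda>x. -1 * g x"] cont_at_0_cmult[of g "-1"] by simp

lemma cont_at_0_limit:
  assumes f: "f \<in> L2" and g: "\<And>n. cont_at_0 (g n)"
    and lim: "(\<lambda>n::nat. nsq (\<lambda>x. f x - g n x)) \<longlonglongrightarrow> 0"
  shows "cont_at_0 f"
  unfolding cont_at_0_def
proof (intro conjI f tendstoI)
  fix e :: real assume e: "0 < e"
  \<comment> \<open>The final estimate counts the approximation error 6 times and the error of
    \<open>g n\<close> 4 times: 6/12 + 4/8 = 1.\<close>
  from order_tendstoD(2)[OF lim, of "e / 12"] e obtain n where n: "nsq (\<lambda>x. f x - g n x) < e / 12"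
    by (auto simp: eventually_sequentially)
  have L: "g n \<in> L2" using g by (rule cont_at_0_L2)
  have "\<forall>\<^sub>F t in at_right 0. nsq (\<lambda>x. T t (g n) x - g n x) < e / 8"
    using g[of n] e by (intro order_tendstoD(2)[of _ 0]) (auto simp: cont_at_0_def)
  then show "\<forall>\<^sub>F t in at_right 0. dist (nsq (\<lambda>x. T t f x - f x)) 0 < e"
    using pos_at_right_0
  proof eventually_elim
    case (elim t)
    let ?h = "\<lambda>x. f x - g n x"
    have h: "?h \<in> L2" "(\<lambda>x. g n x - f x) \<in> L2" using f L by (auto intro: L2_diff)
    have Lg: "(\<lambda>x. T t (g n) x - g n x) \<in> L2" using L elim by (intro L2_diff T_L2) auto
    have "nsq (\<lambda>x. T t f x - f x) = nsq (\<lambda>x. T t ?h x + ((T t (g n) x - g n x) + (g n x - f x)))"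
      using f L elim by (intro nsq_cong) (simp add: T_diff)
    also have "\<dots> \<le> 2 * nsq (T t ?h) + 2 * nsq (\<lambda>x. (T t (g n) x - g n x) + (g n x - f x))"
      using h Lg elim by (intro nsq_add_le T_L2 L2_add) auto
    also have "\<dots> \<le> 2 * nsq ?h + 2 * (2 * nsq (\<lambda>x. T t (g n) x - g n x) + 2 * nsq (\<lambda>x. g n x - f x))"
      using nsq_T_le[OF h(1), of t] nsq_add_le[OF Lg h(2)] elim by simp
    also have "\<dots> < e" using n elim nsq_swap[of "g n" f] by simp
    finally show ?case by (simp add: nsq_nonneg)
  qed
qed

section \<open>From indicators of a generator to all of L2\<close>

lemma cont_at_0_zero: "cont_at_0 (\<lambda>_. 0)"
proof -
  have "T t (\<lambda>_. 0) = (\<lambda>_. 0)" for t by (auto simp: T_def)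
  then show ?thesis by (simp add: cont_at_0_def L2_def nsq_def)
qed

text \<open>Dynkin's pi-lambda argument. It takes place inside a set \<open>B\<close> of finite
  measure, since indicators of complements would otherwise leave L2.\<close>

lemma cont_at_0_indicator:
  assumes G: "Int_stable G" "G \<subseteq> Pow (space M)" "sets M = sigma_sets (space M) G"
    and B: "B \<in> G" "emeasure M B < \<infinity>"
    and base: "\<And>S. S \<in> G \<Longrightarrow> cont_at_0 (indicator (S \<inter> B))"
    and S: "S \<in> sets M"
  shows "cont_at_0 (indicator (S \<inter> B))"
  using G(1,2) S[unfolded G(3)]
proof (induction rule: sigma_sets_induct_disjoint)
  case empty
  show ?case using cont_at_0_zero by simp
next
  case (compl S)
  have "(indicator ((space M - S) \<inter> B) :: 'a \<Rightarrow> real) = (\<lambda>x. indicator (B \<inter> B) x - indicator (S \<inter> B) x)"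
    using G(2) B(1) by (auto simp: indicator_def fun_eq_iff)
  then show ?case using cont_at_0_diff[OF base[OF B(1)] compl.IH] by simp
next
  case (union S)
  have meas: "S i \<in> sets M" "B \<in> sets M" for i using union(2) B(1) G(3) by auto
  have *: "cont_at_0 (indicator ((\<Union>i<n. S i) \<inter> B))" for n
  proof (induction n)
    case 0
    show ?case using cont_at_0_zero by simp
  next
    case (Suc n)
    have "S n \<inter> (\<Union>i<n. S i) = {}"
      using disjoint_family_onD[OF union(1), of n] by fastforce
    then have "(indicator ((\<Union>i<Suc n. S i) \<inter> B) :: 'a \<Rightarrow> real) = (\<lambda>x. indicator ((\<Union>i<n. S i) \<inter> B) x + indicator (S n \<inter> B) x)"
      by (auto simp: indicator_def fun_eq_iff lessThan_Suc)
    then show ?case using cont_at_0_add[OF Suc union(3)[of n]] by simp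
  qed
  show ?case
  proof (rule cont_at_0_limit[OF _ *])
    have L: "indicator ((\<Union>i. S i) \<inter> B) \<in> L2"
    proof (rule L2_indicator)
      show "emeasure M (\<Union> (range S) \<inter> B) < \<infinity>"
        by (rule le_less_trans[OF emeasure_mono B(2)]) (use meas in auto)
    qed (use meas in auto)
    then show "indicator (\<Union> (range S) \<inter> B) \<in> L2" .
    show "(\<lambda>n. nsq (\<lambda>x. indicator (\<Union> (range S) \<inter> B) x - indicator (\<Union> (S ` {..<n}) \<inter> B) x)) \<longlonglongrightarrow> 0"
    proof (rule nsq_tendsto_0[OF L])
      fix x
      have "(\<lambda>n. indicator (\<Union>i<n. S i) x * indicator B x :: real) \<longlonglongrightarrow> indicator (\<Union>i. S i) x * indicator B x"
        by (intro tendsto_mult tendsto_const LIMSEQ_indicator_UN)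
      then show "(\<lambda>n. indicator (\<Union> (S ` {..<n}) \<inter> B) x :: real) \<longlonglongrightarrow> indicator (\<Union> (range S) \<inter> B) x"
        by (simp add: indicator_inter_arith)
    qed (use meas in \<open>auto simp: indicator_def\<close>)
  qed
qed (use base in simp)

text \<open>Induction over nonnegative measurable functions, with membership in L2 carried as a
  premise of the induction claim; intermediate functions inherit it by domination or by
  rescaling.\<close>

lemma cont_at_0_bounded_support:
  assumes ind: "\<And>S. S \<in> sets M \<Longrightarrow> cont_at_0 (indicator (S \<inter> B))"
    and B: "B \<in> sets M"
    and f: "f \<in> borel_measurable M" "\<And>x. 0 \<le> f x"
    and L: "(\<lambda>x. f x * indicator B x) \<in> L2"
  shows "cont_at_0 (\<lambda>x. f x * indicator B x)"
  using f L
proof (induction rule: borel_measurable_induct_real)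
  case (set S)
  have "indicator (S \<inter> B) = (\<lambda>x. indicator S x * indicator B x :: real)"
    by (simp add: fun_eq_iff indicator_inter_arith)
  then show ?case using ind[OF set(1)] by simp
next
  case (mult u c)
  show ?case
  \<comment> \<open>For \<open>c = 0\<close> the premise on the multiple says nothing about
    \<open>u\<close>.\<close>
  proof (cases "c = 0")
    case True
    then show ?thesis using cont_at_0_zero by simp
  next
    case False
    have "(\<lambda>x. u x * indicator B x) \<in> L2"
      using L2_cmult[OF mult.prems, of "1 / c"] False by (simp add: mult.assoc)
    from cont_at_0_cmult[OF mult.IH[OF this], of c] show ?thesis by (simp add: mult.assoc)
  qed
next
  case (add u v)
  have "(\<lambda>x. u x * indicator B x) \<in> L2" "(\<lambda>x. v x * indicator B x) \<in> L2"
    using add.hyps B by (auto intro!: L2_bound[OF add.prems] simp: indicator_def)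
  with cont_at_0_add[OF add.IH(2)[OF this(2)] add.IH(1)[OF this(1)]] show ?case
    by (simp add: distrib_right add.commute)
next
  case (seq U)
  have le: "U i x \<le> f x" if "x \<in> space M" for i x
    using seq.hyps(4)[OF that] seq.hyps(3) by (intro incseq_le) (auto simp: incseq_def le_fun_def)
  have le': "\<bar>U i x * indicator B x\<bar> \<le> \<bar>f x * indicator B x\<bar>" if "x \<in> space M" for i x
    using le[OF that, of i] seq.hyps(2)[of i x] by (simp add: indicator_def)
  have U: "(\<lambda>x. U i x * indicator B x) \<in> L2" for i
    using seq.hyps(1) B le' by (intro L2_bound[OF seq.prems]) auto
  show ?case
  proof (rule cont_at_0_limit[OF seq.prems seq.IH[OF U]])
    show "(\<lambda>n. nsq (\<lambda>x. f x * indicator B x - U n x * indicator B x)) \<longlonglongrightarrow> 0"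
      using U le' seq.hyps(4) by (intro nsq_tendsto_0 seq.prems L2D[OF U] tendsto_mult tendsto_const) auto
  qed
qed

text \<open>Split into positive and negative parts on each \<open>B n\<close>, then let the sets
  exhaust the space.\<close>

lemma cont_at_0_L2_all:
  assumes G: "Int_stable G" "G \<subseteq> Pow (space M)" "sets M = sigma_sets (space M) G"
    and B: "range B \<subseteq> G" "\<And>n::nat. emeasure M (B n) < \<infinity>" "incseq B" "(\<Union>n. B n) = space M"
    and base: "\<And>S n. S \<in> G \<Longrightarrow> cont_at_0 (indicator (S \<inter> B n))"
    and f: "f \<in> L2"
  shows "cont_at_0 f"
proof -
  have Bm: "B n \<in> sets M" for n using B(1) G(3) by auto
  note [measurable] = L2D[OF f]
  have bdd: "cont_at_0 (\<lambda>x. g x * indicator (B n) x)" if "g \<in> L2" "\<And>x. 0 \<le> g x" for g n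
    using that Bm B(1,2)
    by (intro cont_at_0_bounded_support cont_at_0_indicator[OF G _ _ base] L2_restrict) auto
  have Bn: "cont_at_0 (\<lambda>x. f x * indicator (B n) x)" for n
  proof -
    have p: "(\<lambda>x. max 0 (f x)) \<in> L2" "(\<lambda>x. max 0 (- f x)) \<in> L2"
      by (auto intro!: L2_bound[OF f])
    have "(\<lambda>x. f x * indicator (B n) x) = (\<lambda>x. max 0 (f x) * indicator (B n) x - max 0 (- f x) * indicator (B n) x)"
      by (auto simp: fun_eq_iff indicator_def)
    then show ?thesis using cont_at_0_diff[OF bdd[OF p(1), of n] bdd[OF p(2), of n]] by simp
  qed
  show ?thesis
  proof (rule cont_at_0_limit[OF f Bn nsq_tendsto_0[OF f]])
    fix x assume "x \<in> space M"
    then have "(\<lambda>n. indicator (B n) x :: real) \<longlonglongrightarrow> indicator (space M) x"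
      using LIMSEQ_indicator_incseq[OF B(3), of x] B(4) by simp
    from tendsto_mult[OF tendsto_const this, of "f x"] \<open>x \<in> space M\<close>
    show "(\<lambda>n. f x * indicator (B n) x) \<longlonglongrightarrow> f x" by simp
  qed (use Bm in \<open>auto simp: abs_mult indicator_def\<close>)
qed

lemma energy_decay_profile:
  assumes "cont_at_0 f"
  shows "decay_profile (energy f)"
proof
  note f = cont_at_0_L2[OF assms]
  show "0 \<le> s \<Longrightarrow> s \<le> t \<Longrightarrow> energy f t \<le> energy f s" for s t
    by (rule energy_antimono[OF f])
  show "0 \<le> energy f t - 2 * energy f (t + h) + energy f (t + 2 * h)" if "0 \<le> t" "0 \<le> h" for t h
    using energy_diff2[OF f that] by (simp add: nsq_nonneg)
  show "energy f t - 2 * energy f (t + h) + energy f (t + 2 * h) \<le> energy f s - 2 * energy f (s + h) + energy f (s + 2 * h)"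
    if "0 \<le> s" "s \<le> t" "0 \<le> h" for s t h
    by (rule energy_diff2_antimono[OF f that])
  show "(energy f \<longlongrightarrow> energy f 0) (at_right 0)" by (rule cont_at_0_imp_energy[OF assms])
  show "(energy f \<longlongrightarrow> 0) at_top" by (rule energy_tendsto_inf[OF f])
qed

end

section \<open>The heat kernel\<close>

text \<open>Time is the variance, so times add under convolution and the scale \<sigma> corresponds
  to time \<sigma>^2.\<close>

definition heat :: "real \<Rightarrow> real \<Rightarrow> real \<Rightarrow> real" where
  "heat t x y = normal_density 0 (sqrt t) (x - y)"

definition heat_sup :: "real \<Rightarrow> real" where
  "heat_sup t = 1 / sqrt (2 * pi * t)"

lemma heat_measurable [measurable]: "(\<lambda>(x, y). heat t x y) \<in> borel_measurable (borel \<Otimes>\<^sub>M borel)"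
  unfolding heat_def by measurable

lemma heat_measurable2 [measurable (raw)]:
  "f \<in> borel_measurable N \<Longrightarrow> g \<in> borel_measurable N \<Longrightarrow> (\<lambda>x. heat t (f x) (g x)) \<in> borel_measurable N"
  unfolding heat_def by measurable

lemma heat_nonneg: "0 \<le> heat t x y"
  by (simp add: heat_def)

lemma heat_sym: "heat t x y = heat t y x"
  by (simp add: heat_def normal_density_def power2_commute)

lemma heat_eq: "heat t x y = normal_density x (sqrt t) y"
  by (simp add: heat_def normal_density_def power2_commute)

lemma heat_mass: "0 < t \<Longrightarrow> (\<integral>\<^sup>+ y. ennreal (heat t x y) \<partial>lborel) = 1"
  unfolding heat_eq by (subst nn_integral_eq_integral) auto

lemma heat_semigroup:
  assumes "0 < s" "0 < t"
  shows "(\<integral>\<^sup>+ y. ennreal (heat s x y * heat t y z) \<partial>lborel) = ennreal (heat (s + t) x z)"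
proof -
  have "(\<integral>\<^sup>+ y. ennreal (heat s x y * heat t y z) \<partial>lborel) =
      (\<integral>\<^sup>+ y. ennreal (normal_density 0 (sqrt s) ((x - z) - y) * normal_density 0 (sqrt t) y) \<partial>lborel)"
    \<comment> \<open>Translation by \<open>z\<close> turns the integral into a convolution of
      centred normal densities.\<close>
    by (subst nn_integral_real_affine[of _ 1 z]) (simp_all add: heat_def algebra_simps)
  also have "\<dots> = ennreal (heat (s + t) x z)"
    using fun_cong[OF conv_normal_density_zero_mean[of "sqrt s" "sqrt t"], of "x - z"] assms
    by (simp add: heat_def)
  finally show ?thesis .
qed

lemma heat_le: "0 < t \<Longrightarrow> heat t x y \<le> heat_sup t"
  by (simp add: heat_def normal_density_def heat_sup_def divide_right_mono)

lemma heat_sup_tendsto: "(heat_sup \<longlongrightarrow> 0) at_top"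
proof -
  have "filterlim (\<lambda>t. 2 * pi * t) at_top at_top"
    by (rule filterlim_tendsto_pos_mult_at_top[OF tendsto_const _ filterlim_ident]) simp
  from filterlim_compose[OF sqrt_at_top this]
  have "((\<lambda>t. inverse (sqrt (2 * pi * t))) \<longlongrightarrow> 0) at_top"
    by (rule tendsto_inverse_0_at_top)
  then show ?thesis by (simp add: heat_sup_def[abs_def] inverse_eq_divide)
qed

interpretation line: markov_kernel lborel heat heat_sup
proof
  show "case_prod (heat t) \<in> borel_measurable (lborel \<Otimes>\<^sub>M lborel)" for t by measurable
  show "0 \<le> heat t x y" for t x y by (rule heat_nonneg)
  show "heat t x y = heat t y x" for t x y by (rule heat_sym)
  show "(\<integral>\<^sup>+ y. ennreal (heat t x y) \<partial>lborel) = 1" if "0 < t" for t x by (rule heat_mass[OF that])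
  show "(\<integral>\<^sup>+ y. ennreal (heat s x y * heat t y z) \<partial>lborel) = ennreal (heat (s + t) x z)"
    if "0 < s" "0 < t" for s t x z by (rule heat_semigroup[OF that])
  show "heat t x y \<le> heat_sup t" if "0 < t" for t x y by (rule heat_le[OF that])
  show "(heat_sup \<longlongrightarrow> 0) at_top" by (rule heat_sup_tendsto)
qed

text \<open>After the substitution y = x + sqrt(S n) z the Gaussian weight is fixed and only the
  indicator depends on \<open>n\<close>. For open \<open>U\<close> it is eventually 1 at each
  \<open>z\<close>, which is why open sets serve as the generator on the line.\<close>

lemma line_T_open_tendsto:
  assumes U: "open U" "x \<in> U" and S: "\<And>n. 0 < S n" "S \<longlonglongrightarrow> 0"
  shows "(\<lambda>n. line.T (S n) (indicator U) x) \<longlonglongrightarrow> 1"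
proof -
  have [measurable]: "U \<in> sets borel" using U by simp
  have eq: "line.T (S n) (indicator U) x = (\<integral>z. std_normal_density z * indicator U (x + sqrt (S n) * z) \<partial>lborel)" for n
  proof -
    have "line.T (S n) (indicator U) x = (\<integral>y. heat (S n) x y * indicator U y \<partial>lborel)"
      using S(1)[of n] by (simp add: line.T_def)
    also have "\<dots> = sqrt (S n) * (\<integral>z. heat (S n) x (x + sqrt (S n) * z) * indicator U (x + sqrt (S n) * z) \<partial>lborel)"
      using S(1)[of n] by (subst lborel_integral_real_affine[where c = "sqrt (S n)" and t = x]) auto
    also have "\<dots> = (\<integral>z. sqrt (S n) * (heat (S n) x (x + sqrt (S n) * z) * indicator U (x + sqrt (S n) * z)) \<partial>lborel)"
      by simp
    also have "\<dots> = (\<integral>z. std_normal_density z * indicator U (x + sqrt (S n) * z) \<partial>lborel)"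
      using S(1)[of n]
      by (intro Bochner_Integration.integral_cong) (auto simp: heat_def normal_density_def real_sqrt_mult power_mult_distrib field_simps)
    finally show ?thesis .
  qed
  have "(\<lambda>n. \<integral>z. std_normal_density z * indicator U (x + sqrt (S n) * z) \<partial>lborel) \<longlonglongrightarrow> (\<integral>z. std_normal_density z \<partial>lborel)"
  proof (rule integral_dominated_convergence[where w = std_normal_density])
    show "AE z in lborel. (\<lambda>n. std_normal_density z * indicator U (x + sqrt (S n) * z)) \<longlonglongrightarrow> std_normal_density z"
    proof (rule AE_I2)
      fix z
      have "(\<lambda>n. x + sqrt (S n) * z) \<longlonglongrightarrow> x + sqrt 0 * z"
        by (intro tendsto_intros S)
      then have "\<forall>\<^sub>F n in sequentially. x + sqrt (S n) * z \<in> U"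
        using U by (intro topological_tendstoD) auto
      then have "\<forall>\<^sub>F n in sequentially. std_normal_density z = std_normal_density z * indicator U (x + sqrt (S n) * z)"
        by eventually_elim simp
      then show "(\<lambda>n. std_normal_density z * indicator U (x + sqrt (S n) * z)) \<longlonglongrightarrow> std_normal_density z"
        by (rule Lim_transform_eventually[OF tendsto_const])
    qed
  qed (auto simp: indicator_def)
  then show ?thesis by (simp add: eq)
qed

lemma line_T_indicator_bounds:
  assumes U: "U \<in> sets borel" and t: "0 < t"
  shows "0 \<le> line.T t (indicator U) x" "line.T t (indicator U) x \<le> 1"
proof -
  show "0 \<le> line.T t (indicator U) x"
    using t by (auto simp: line.T_def heat_nonneg intro!: integral_nonneg_AE)
  have "line.T t (indicator U) x = (\<integral>y. heat t x y * indicator U y \<partial>lborel)"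
    using t by (simp add: line.T_def)
  also have "\<dots> \<le> (\<integral>y. heat t x y \<partial>lborel)"
    using U t line.K_integrable[of t x]
    by (intro integral_mono integrable_real_mult_indicator) (auto simp: heat_nonneg indicator_def)
  finally show "line.T t (indicator U) x \<le> 1" using line.K_integral[of t x] t by simp
qed

text \<open>The energy pairs \<open>T t\<close> of the indicator with the indicator itself, so
  convergence at the points of \<open>U\<close> suffices, and nothing has to be known at its
  boundary.\<close>

lemma line_cont_at_0_open:
  assumes U: "open U" "emeasure lborel U < \<infinity>"
  shows "line.cont_at_0 (indicator U)"
proof (rule line.energy_imp_cont_at_0)
  have [measurable]: "U \<in> sets borel" using U by simp
  show L: "indicator U \<in> line.L2" using U by (intro line.L2_indicator) auto
  show "(line.energy (indicator U) \<longlongrightarrow> line.nsq (indicator U)) (at_right 0)"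
  proof (rule tendsto_at_right_sequentially[of 0 1])
    fix S :: "nat \<Rightarrow> real" assume S: "\<And>n. 0 < S n" "S \<longlonglongrightarrow> 0"
    have "(\<lambda>n. \<integral>x. indicator U x * line.T (S n) (indicator U) x \<partial>lborel) \<longlonglongrightarrow> (\<integral>x. (indicator U x)\<^sup>2 \<partial>lborel)"
    proof (rule integral_dominated_convergence[where w = "indicator U"])
      show "integrable lborel (indicat_real U)" using U by (simp add: less_top)
      show "AE x in lborel. (\<lambda>n. indicat_real U x * line.T (S n) (indicat_real U) x) \<longlonglongrightarrow> (indicat_real U x)\<^sup>2"
      proof (rule AE_I2)
        fix x show "(\<lambda>n. indicat_real U x * line.T (S n) (indicat_real U) x) \<longlonglongrightarrow> (indicat_real U x)\<^sup>2"
          using line_T_open_tendsto[OF U(1) _ S, of x] by (cases "x \<in> U") auto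
      qed
      show "AE x in lborel. norm (indicat_real U x * line.T (S n) (indicat_real U) x) \<le> indicat_real U x" for n
        using line_T_indicator_bounds[of U "S n"] S(1)[of n] by (auto simp: indicator_def)
    qed measurable
    then show "(\<lambda>n. line.energy (indicat_real U) (S n)) \<longlonglongrightarrow> line.nsq (indicat_real U)"
      by (simp add: line.energy_def line.ip_def line.nsq_def)
  qed simp
qed

lemma line_cont_at_0:
  assumes "f \<in> line.L2"
  shows "line.cont_at_0 f"
proof (rule line.cont_at_0_L2_all[OF _ _ _ _ _ _ _ _ assms])
  let ?G = "{S :: real set. open S}" and ?B = "\<lambda>n::nat. {- real n<..<real n}"
  show "Int_stable ?G" by (auto simp: Int_stable_def)
  show "?G \<subseteq> Pow (space lborel)" by simp
  show "sets lborel = sigma_sets (space lborel) ?G" by (simp add: borel_def)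
  show "range ?B \<subseteq> ?G" by auto
  show "emeasure lborel (?B n) < \<infinity>" for n by simp
  show "incseq ?B" by (auto simp: incseq_def)
  show "(\<Union>n. ?B n) = space lborel"
  proof -
    have "\<exists>n. x \<in> ?B n" for x :: real
    proof -
      obtain n :: nat where "\<bar>x\<bar> < real n" using reals_Archimedean2 by blast
      then show ?thesis by (intro exI[of _ n]) auto
    qed
    then show ?thesis by auto
  qed
  show "line.cont_at_0 (indicator (S \<inter> ?B n))" if "S \<in> ?G" for S n
  proof (rule line_cont_at_0_open)
    show "open (S \<inter> ?B n)" using that by auto
    have "emeasure lborel (S \<inter> ?B n) \<le> emeasure lborel (?B n)" by (rule emeasure_mono) auto
    then show "emeasure lborel (S \<inter> ?B n) < \<infinity>" by (rule le_less_trans) simp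
  qed
qed

section \<open>The heat semigroup in dimension \<open>n\<close>\<close>

abbreviation borel_Rn :: "nat \<Rightarrow> (nat \<Rightarrow> real) measure" where
  "borel_Rn n \<equiv> Pi\<^sub>M {..<n} (\<lambda>_. lborel)"

definition heat_Rn :: "nat \<Rightarrow> real \<Rightarrow> (nat \<Rightarrow> real) \<Rightarrow> (nat \<Rightarrow> real) \<Rightarrow> real" where
  "heat_Rn n t x y = (\<Prod>i<n. heat t (x i) (y i))"

interpretation lb: product_sigma_finite "\<lambda>_ :: nat. lborel :: real measure" ..

locale heat_space =
  fixes n :: nat
  assumes n_pos: "1 \<le> n"
begin

sublocale markov_kernel "borel_Rn n" "heat_Rn n" "\<lambda>t. heat_sup t ^ n"
proof -
  interpret finite_product_sigma_finite "\<lambda>_ :: nat. lborel :: real measure" "{..<n}" by standard simp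
  show "markov_kernel (borel_Rn n) (heat_Rn n) (\<lambda>t. heat_sup t ^ n)"
  proof
    show "case_prod (heat_Rn n t) \<in> borel_measurable (borel_Rn n \<Otimes>\<^sub>M borel_Rn n)" for t
      unfolding heat_Rn_def by measurable
    show "0 \<le> heat_Rn n t x y" for t x y
      by (simp add: heat_Rn_def prod_nonneg heat_nonneg)
    show "heat_Rn n t x y = heat_Rn n t y x" for t x y
      by (simp add: heat_Rn_def heat_sym)
    show "(\<integral>\<^sup>+ y. ennreal (heat_Rn n t x y) \<partial>borel_Rn n) = 1" if "0 < t" for t x
      using that lb.product_nn_integral_prod[of "{..<n}" "\<lambda>i y. ennreal (heat t (x i) y)"]
      by (simp add: heat_Rn_def heat_mass heat_nonneg flip: prod_ennreal)
    show "(\<integral>\<^sup>+ y. ennreal (heat_Rn n s x y * heat_Rn n t y z) \<partial>borel_Rn n) = ennreal (heat_Rn n (s + t) x z)"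
      if "0 < s" "0 < t" for s t x z
      using that lb.product_nn_integral_prod[of "{..<n}" "\<lambda>i y. ennreal (heat s (x i) y * heat t y (z i))"]
      by (simp add: heat_Rn_def heat_semigroup heat_nonneg prod_ennreal flip: prod.distrib)
    show "heat_Rn n t x y \<le> heat_sup t ^ n" if "0 < t" for t x y
      using prod_mono[of "{..<n}" "\<lambda>i. heat t (x i) (y i)" "\<lambda>_. heat_sup t"] that
      by (simp add: heat_Rn_def heat_nonneg heat_le)
    \<comment> \<open>Positive dimension is used here: for \<open>n = 0\<close> the power would be
      constantly 1.\<close>
    show "((\<lambda>t. heat_sup t ^ n) \<longlongrightarrow> 0) at_top"
      using tendsto_power[OF heat_sup_tendsto, of n] n_pos by (simp add: power_0_left)
  qed
qed

lemma indicator_PiE: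
  "x \<in> space (borel_Rn n) \<Longrightarrow> indicator (\<Pi>\<^sub>E i\<in>{..<n}. E i) x = (\<Prod>i<n. indicator (E i) (x i) :: real)"
  by (auto simp: indicator_def space_PiM PiE_iff)

lemma energy_PiE:
  assumes E: "\<And>i. i < n \<Longrightarrow> indicator (E i) \<in> line.L2" and t: "0 \<le> t"
  shows "energy (indicator (\<Pi>\<^sub>E i\<in>{..<n}. E i)) t = (\<Prod>i<n. line.energy (indicator (E i)) t)"
proof -
  have T: "T t (indicator (\<Pi>\<^sub>E i\<in>{..<n}. E i)) x = (\<Prod>i<n. line.T t (indicator (E i)) (x i))"
    if x: "x \<in> space (borel_Rn n)" for x
  proof (cases "t = 0")
    case False
    have "T t (indicator (\<Pi>\<^sub>E i\<in>{..<n}. E i)) x = (\<integral>y. (\<Prod>i<n. heat t (x i) (y i) * indicator (E i) (y i)) \<partial>borel_Rn n)"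
      using False by (auto simp: T_def heat_Rn_def indicator_PiE prod.distrib intro!: Bochner_Integration.integral_cong)
    also have "\<dots> = (\<Prod>i<n. \<integral>y. heat t (x i) y * indicator (E i) y \<partial>lborel)"
      using E t False by (intro lb.product_integral_prod line.K_mult_integrable) auto
    finally show ?thesis using False by (simp add: line.T_def)
  qed (simp add: indicator_PiE that)
  have "energy (indicator (\<Pi>\<^sub>E i\<in>{..<n}. E i)) t = (\<integral>x. (\<Prod>i<n. indicator (E i) (x i) * line.T t (indicator (E i)) (x i)) \<partial>borel_Rn n)"
    unfolding energy_def ip_def by (intro Bochner_Integration.integral_cong) (auto simp: T indicator_PiE prod.distrib)
  also have "\<dots> = (\<Prod>i<n. line.energy (indicator (E i)) t)"
    unfolding line.energy_def line.ip_def
    using E t by (intro lb.product_integral_prod line.L2_mult_integrable line.T_L2) auto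
  finally show ?thesis .
qed

text \<open>The generator consists of measurable boxes. Cut by a cube, a box has sides of finite
  measure, and its energy is a finite product of energies on the line, each of which is continuous
  at 0.\<close>

lemma cont_at_0_all:
  assumes "f \<in> L2"
  shows "cont_at_0 f"
proof (rule cont_at_0_L2_all[OF _ _ _ _ _ _ _ _ assms])
  let ?G = "prod_algebra {..<n} (\<lambda>_. lborel :: real measure)"
  let ?I = "\<lambda>k::nat. {- real k<..<real k}"
  let ?B = "\<lambda>k::nat. \<Pi>\<^sub>E i\<in>{..<n}. ?I k"
  note G = prod_algebra_eq_finite[of "{..<n}" "\<lambda>_. lborel :: real measure"]
  show "Int_stable ?G" by (rule Int_stable_prod_algebra)
  show "?G \<subseteq> Pow (space (borel_Rn n))" using prod_algebra_sets_into_space[of "{..<n}" "\<lambda>_. lborel :: real measure"] by (simp add: space_PiM)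
  show "sets (borel_Rn n) = sigma_sets (space (borel_Rn n)) ?G" by (simp add: sets_PiM space_PiM)
  show "range ?B \<subseteq> ?G" unfolding G[OF finite_lessThan] by auto
  show "emeasure (borel_Rn n) (?B k) < \<infinity>" for k
    by (subst lb.emeasure_PiM) (simp_all add: power_less_top_ennreal)
  show "incseq ?B" unfolding incseq_def by (intro allI impI PiE_mono) auto
  show "(\<Union>k. ?B k) = space (borel_Rn n)"
  proof -
    have "\<exists>k. x \<in> ?B k" if x: "x \<in> space (borel_Rn n)" for x
    proof -
      obtain k where k: "(\<Sum>i<n. \<bar>x i\<bar>) < real k" using reals_Archimedean2 by blast
      have "x i \<in> ?I k" if "i < n" for i
      proof -
        have "\<bar>x i\<bar> < real k"
          using member_le_sum[of i "{..<n}" "\<lambda>i. \<bar>x i\<bar>"] k that by simp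
        then show ?thesis by auto
      qed
      then show ?thesis using x by (intro exI[of _ k]) (simp add: space_PiM PiE_iff)
    qed
    then show ?thesis by (auto simp: space_PiM)
  qed
  show "cont_at_0 (indicator (S \<inter> ?B k))" if "S \<in> ?G" for S k
  proof -
    obtain X where X: "S = (\<Pi>\<^sub>E i\<in>{..<n}. X i)" "\<And>i. i < n \<Longrightarrow> X i \<in> sets borel"
    proof -
      have "S \<in> {(\<Pi>\<^sub>E i\<in>{..<n}. X i) |X. X \<in> (\<Pi> i\<in>{..<n}. sets lborel)}"
        using \<open>S \<in> ?G\<close> G by simp
      then show thesis using that by (auto simp: Pi_iff)
    qed
    define E where "E i = X i \<inter> ?I k" for i
    have S: "S \<inter> ?B k = (\<Pi>\<^sub>E i\<in>{..<n}. E i)" by (auto simp: X(1) E_def PiE_iff)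
    have Em: "E i \<in> sets lborel" "emeasure lborel (E i) < \<infinity>" if "i < n" for i
    proof -
      show "E i \<in> sets lborel" using X(2)[OF that] by (simp add: E_def)
      have "emeasure lborel (E i) \<le> emeasure lborel (?I k)" unfolding E_def by (rule emeasure_mono) auto
      then show "emeasure lborel (E i) < \<infinity>" by (rule le_less_trans) simp
    qed
    have EL: "indicator (E i) \<in> line.L2" if "i < n" for i
      using Em[OF that] by (rule line.L2_indicator)
    show ?thesis unfolding S
    proof (rule energy_imp_cont_at_0)
      show "indicator (Pi\<^sub>E {..<n} E) \<in> L2"
      proof (rule L2_indicator)
        show "Pi\<^sub>E {..<n} E \<in> sets (borel_Rn n)" using Em by (intro sets_PiM_I_finite) auto
        have "emeasure (borel_Rn n) (Pi\<^sub>E {..<n} E) = (\<Prod>i<n. emeasure lborel (E i))"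
          using Em by (intro lb.emeasure_PiM) auto
        then show "emeasure (borel_Rn n) (Pi\<^sub>E {..<n} E) < \<infinity>"
          using Em(2) by (simp add: less_top[symmetric] ennreal_prod_eq_top)
      qed
      have "((\<lambda>t. \<Prod>i<n. line.energy (indicator (E i)) t) \<longlongrightarrow> (\<Prod>i<n. line.energy (indicator (E i)) 0)) (at_right 0)"
        using EL by (intro tendsto_prod line.cont_at_0_imp_energy line_cont_at_0) auto
      moreover have "\<forall>\<^sub>F t in at_right 0. (\<Prod>i<n. line.energy (indicator (E i)) t) = energy (indicator (Pi\<^sub>E {..<n} E)) t"
        using pos_at_right_0 by eventually_elim (simp add: energy_PiE EL)
      ultimately show "(energy (indicator (Pi\<^sub>E {..<n} E)) \<longlongrightarrow> nsq (indicator (Pi\<^sub>E {..<n} E))) (at_right 0)"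
        using energy_PiE[of E 0] EL by (simp add: Lim_transform_eventually flip: energy_0)
    qed
  qed
qed

section \<open>Filter responses of real functions and their frame bounds\<close>

definition response :: "real \<Rightarrow> real \<Rightarrow> int \<Rightarrow> ((nat \<Rightarrow> real) \<Rightarrow> real) \<Rightarrow> (nat \<Rightarrow> real) \<Rightarrow> real" where
  "response r \<sigma>0 s f x = T ((scale r \<sigma>0 s)\<^sup>2) f x - T ((scale r \<sigma>0 (s - 1))\<^sup>2) f x"

lemma response_L2: "f \<in> L2 \<Longrightarrow> response r \<sigma>0 s f \<in> L2"
  unfolding response_def[abs_def] by (intro L2_diff T_L2) auto

lemma response_frame:
  assumes f: "f \<in> L2" and r: "1 < r" and \<sigma>: "0 < \<sigma>0"
  shows "(\<lambda>s. nsq (response r \<sigma>0 s f)) summable_on UNIV"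
    and "nsq f \<le> frame_const (r\<^sup>2) * (\<Sum>\<^sub>\<infinity>s. nsq (response r \<sigma>0 s f))"
    and "(\<Sum>\<^sub>\<infinity>s. nsq (response r \<sigma>0 s f)) \<le> nsq f"
proof -
  interpret decay_profile "energy f"
    by (rule energy_decay_profile[OF cont_at_0_all[OF f]])
  \<comment> \<open>The 2 comes from \<open>nsq (T t f) = energy f (2 * t)\<close>; the division by
    \<open>r\<close> is due to the filter with index \<open>s\<close> starting at scale
    \<open>s - 1\<close>.\<close>
  define q x0 where "q = r\<^sup>2" and "x0 = 2 * (\<sigma>0 / r)\<^sup>2"
  have q: "1 < q" and x0: "0 < x0" using r \<sigma> by (auto simp: q_def x0_def power_less_one_iff one_less_power)
  have "nsq (response r \<sigma>0 s f) = band q x0 s" for s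
  proof -
    let ?a = "(scale r \<sigma>0 s)\<^sup>2" and ?b = "(scale r \<sigma>0 (s - 1))\<^sup>2"
    have b: "node q x0 s = 2 * ?b"
      unfolding node_def[OF q x0] using r
      by (simp add: scale_def q_def x0_def power_int_diff power_mult_distrib power_divide power_int_power' power_int_power mult.commute)
    have "scale r \<sigma>0 s = r * scale r \<sigma>0 (s - 1)" using r by (simp add: scale_def power_int_diff)
    then have a: "?a = q * ?b" by (simp add: q_def power_mult_distrib)
    have "band q x0 s = diff2 (2 * ?b) ((q - 1) * ?b)"
      by (simp add: band_def[OF q x0] b)
    also have "\<dots> = nsq (\<lambda>x. T (2 * ?b / 2) f x - T (2 * ?b / 2 + (q - 1) * ?b) f x)"
      unfolding diff2_def using q by (intro energy_diff2[OF f]) auto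
    also have "\<dots> = nsq (\<lambda>x. T ?b f x - T ?a f x)"
    proof -
      have "2 * ?b / 2 + (q - 1) * ?b = ?a" "2 * ?b / 2 = ?b" by (simp_all add: a algebra_simps)
      then show ?thesis by (simp only:)
    qed
    also have "\<dots> = nsq (response r \<sigma>0 s f)"
      unfolding response_def[abs_def] by (rule nsq_swap)
    finally show ?thesis by simp
  qed
  then have eq: "(\<lambda>s. nsq (response r \<sigma>0 s f)) = band q x0" by auto
  show "(\<lambda>s. nsq (response r \<sigma>0 s f)) summable_on UNIV"
    unfolding eq by (rule band_summable[OF q x0])
  show "nsq f \<le> frame_const (r\<^sup>2) * (\<Sum>\<^sub>\<infinity>s. nsq (response r \<sigma>0 s f))"
    unfolding eq using infsum_band_ge[OF q x0] by (simp add: energy_0 q_def)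
  show "(\<Sum>\<^sub>\<infinity>s. nsq (response r \<sigma>0 s f)) \<le> nsq f"
    unfolding eq using infsum_band_le[OF q x0] by (simp add: energy_0)
qed

section \<open>Passage to Gaussian filters, complex functions and the completed measure\<close>

lemma gaussian_diff_eq:
  assumes "0 < \<sigma>"
  shows "gaussian n \<sigma> (diff_Rn n x y) = heat_Rn n (\<sigma>\<^sup>2) x y"
proof -
  have "heat_Rn n (\<sigma>\<^sup>2) x y = (\<Prod>i<n. 1 / sqrt (2 * pi * \<sigma>\<^sup>2) * exp (- (x i - y i)\<^sup>2 / (2 * \<sigma>\<^sup>2)))"
    using assms by (simp add: heat_Rn_def heat_def normal_density_def)
  also have "\<dots> = (1 / sqrt (2 * pi * \<sigma>\<^sup>2)) ^ n * exp (\<Sum>i<n. - (x i - y i)\<^sup>2 / (2 * \<sigma>\<^sup>2))"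
    by (simp only: prod.distrib exp_sum finite_lessThan) simp
  also have "(\<Sum>i<n. - (x i - y i)\<^sup>2 / (2 * \<sigma>\<^sup>2)) = - (norm_Rn n (diff_Rn n x y))\<^sup>2 / (2 * \<sigma>\<^sup>2)"
    by (simp add: norm_Rn_def L2_set_def diff_Rn_def sum_nonneg sum_divide_distrib sum_negf)
  also have "(1 / sqrt (2 * pi * \<sigma>\<^sup>2)) ^ n = (2 * pi * \<sigma>\<^sup>2) powr (- real n / 2)"
  proof -
    define w where "w = 2 * pi * \<sigma>\<^sup>2"
    have w: "0 < w" using assms by (simp add: w_def)
    have "w powr (- real n / 2) = (w powr (- 1 / 2)) powr real n" by (simp add: powr_powr)
    also have "\<dots> = (w powr (- (1 / 2))) ^ n" using w by (simp add: powr_realpow)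
    also have "w powr (- (1 / 2)) = 1 / sqrt w" using w by (simp add: powr_minus_divide powr_half_sqrt)
    finally show ?thesis by (simp add: w_def)
  qed
  finally show ?thesis by (simp add: gaussian_def)
qed

text \<open>Real and imaginary part agree almost everywhere with Borel functions, to which the
  semigroup results apply.\<close>

lemma L2_Rn_representative:
  assumes u: "u \<in> L2_Rn n"
  obtains a b where "a \<in> L2" "b \<in> L2" "AE y in lebesgue_Rn n. u y = Complex (a y) (b y)"
proof -
  have um [measurable]: "u \<in> borel_measurable (completion (borel_Rn n))"
    and ui: "integrable (completion (borel_Rn n)) (\<lambda>x. (cmod (u x))\<^sup>2)"
    using u by (auto simp: L2_Rn_def lebesgue_Rn_def)
  have "(\<lambda>x. Re (u x)) \<in> borel_measurable (completion (borel_Rn n))" by measurable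
  from completion_ex_borel_measurable_real[OF this] obtain a
    where [measurable]: "a \<in> borel_measurable (borel_Rn n)" and ae_a: "AE x in borel_Rn n. Re (u x) = a x" by blast
  have "(\<lambda>x. Im (u x)) \<in> borel_measurable (completion (borel_Rn n))" by measurable
  from completion_ex_borel_measurable_real[OF this] obtain b
    where [measurable]: "b \<in> borel_measurable (borel_Rn n)" and ae_b: "AE x in borel_Rn n. Im (u x) = b x" by blast
  have aeC: "AE x in completion (borel_Rn n). u x = Complex (a x) (b x)"
    using AE_completion[OF ae_a] AE_completion[OF ae_b] by eventually_elim (simp add: complex_eq_iff)
  have L2I: "c \<in> L2" if [measurable]: "c \<in> borel_measurable (borel_Rn n)"
    and c: "\<And>z x. z = Complex (a x) (b x) \<Longrightarrow> \<bar>c x\<bar> \<le> cmod z" for c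
  proof -
    have "c \<in> borel_measurable (completion (borel_Rn n))" by (rule measurable_completion) measurable
    then have m: "(\<lambda>x. (c x)\<^sup>2) \<in> borel_measurable (completion (borel_Rn n))" by (rule borel_measurable_power)
    have "AE x in completion (borel_Rn n). norm ((c x)\<^sup>2) \<le> norm ((cmod (u x))\<^sup>2)"
      using aeC
    proof eventually_elim
      case (elim x)
      from c[OF this] show ?case by (simp add: abs_le_square_iff[symmetric])
    qed
    from Bochner_Integration.integrable_bound[OF ui m this]
    have "integrable (completion (borel_Rn n)) (\<lambda>x. (c x)\<^sup>2)" .
    then show ?thesis by (simp add: L2_def integrable_completion)
  qed
  show ?thesis
  proof (rule that)
    show "a \<in> L2" "b \<in> L2"
      by (auto intro!: L2I simp: complex_norm)
    show "AE y in lebesgue_Rn n. u y = Complex (a y) (b y)"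
      using aeC unfolding lebesgue_Rn_def .
  qed
qed

lemma L2_norm_Complex:
  assumes a: "a \<in> L2" and b: "b \<in> L2" and u: "u \<in> borel_measurable (lebesgue_Rn n)"
    and ae: "AE x in lebesgue_Rn n. u x = Complex (a x) (b x)"
  shows "u \<in> L2_Rn n" and "(L2_norm n u)\<^sup>2 = nsq a + nsq b"
proof -
  note [measurable] = L2D[OF a] L2D[OF b]
  have um [measurable]: "u \<in> borel_measurable (completion (borel_Rn n))"
    using u by (simp add: lebesgue_Rn_def)
  have m: "(\<lambda>x. (a x)\<^sup>2 + (b x)\<^sup>2) \<in> borel_measurable (borel_Rn n)" by measurable
  have ae': "AE x in completion (borel_Rn n). (cmod (u x))\<^sup>2 = (a x)\<^sup>2 + (b x)\<^sup>2"
    using ae unfolding lebesgue_Rn_def by eventually_elim (simp add: cmod_power2)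
  have i: "integrable (borel_Rn n) (\<lambda>x. (a x)\<^sup>2 + (b x)\<^sup>2)"
    using a b by (intro Bochner_Integration.integrable_add L2_square_integrable)
  have um2: "(\<lambda>x. (cmod (u x))\<^sup>2) \<in> borel_measurable (completion (borel_Rn n))" by measurable
  note mC = measurable_completion[OF m]
  have "integrable (completion (borel_Rn n)) (\<lambda>x. (cmod (u x))\<^sup>2)"
    using integrable_cong_AE[OF um2 mC ae'] i by (simp add: integrable_completion m)
  then show "u \<in> L2_Rn n" using u by (simp add: L2_Rn_def lebesgue_Rn_def)
  have "(\<integral>x. (cmod (u x))\<^sup>2 \<partial>lebesgue_Rn n) = (\<integral>x. (a x)\<^sup>2 + (b x)\<^sup>2 \<partial>borel_Rn n)"
    unfolding lebesgue_Rn_def using integral_cong_AE[OF um2 mC ae'] by (simp add: integral_completion m)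
  also have "\<dots> = nsq a + nsq b" using a b by (simp add: nsq_def L2_square_integrable)
  finally show "(L2_norm n u)\<^sup>2 = nsq a + nsq b"
    by (simp add: L2_norm_def nsq_nonneg)
qed

text \<open>The equality holds at every point although \<open>u\<close> is known only almost
  everywhere, because the integral ignores null sets. The filter is real, so it acts on the two
  parts separately.\<close>

lemma convolution_eq:
  assumes a: "a \<in> L2" and b: "b \<in> L2" and u: "u \<in> borel_measurable (lebesgue_Rn n)"
    and ae: "AE x in lebesgue_Rn n. u x = Complex (a x) (b x)"
    and r: "1 < r" and \<sigma>: "0 < \<sigma>0" and x: "x \<in> space (borel_Rn n)"
  shows "convolution_Rn n u (DoG_filter n r \<sigma>0 s) x = Complex (response r \<sigma>0 s a x) (response r \<sigma>0 s b x)"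
proof -
  note [measurable] = L2D[OF a] L2D[OF b] x
  have um: "u \<in> borel_measurable (completion (borel_Rn n))"
    using u by (simp add: lebesgue_Rn_def)
  define \<alpha> \<beta> where "\<alpha> = (scale r \<sigma>0 s)\<^sup>2" and "\<beta> = (scale r \<sigma>0 (s - 1))\<^sup>2"
  have pos: "0 < scale r \<sigma>0 s" for s using r \<sigma> by (simp add: scale_def)
  have \<alpha>: "0 < \<alpha>" and \<beta>: "0 < \<beta>" using pos[of s] pos[of "s - 1"] by (auto simp: \<alpha>_def \<beta>_def)
  define k where "k y = heat_Rn n \<alpha> x y - heat_Rn n \<beta> x y" for y
  have k: "k \<in> borel_measurable (borel_Rn n)" unfolding k_def by measurable
  have DoG: "DoG_filter n r \<sigma>0 s (diff_Rn n x y) = k y" for y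
    using pos by (simp add: DoG_filter_def gaussian_diff_eq k_def \<alpha>_def \<beta>_def)
  have int: "integrable (borel_Rn n) (\<lambda>y. k y * c y)" "(\<integral>y. k y * c y \<partial>borel_Rn n) = response r \<sigma>0 s c x"
    if "c \<in> L2" for c
    using K_mult_integrable[OF that \<alpha> x] K_mult_integrable[OF that \<beta> x] \<alpha> \<beta>
    by (simp_all add: k_def left_diff_distrib response_def T_def flip: \<alpha>_def \<beta>_def)
  have m: "(\<lambda>y. Complex (a y) (b y) * complex_of_real (k y)) \<in> borel_measurable (borel_Rn n)"
    using k by (simp add: Complex_eq)
  have "convolution_Rn n u (DoG_filter n r \<sigma>0 s) x = (\<integral>y. u y * complex_of_real (k y) \<partial>completion (borel_Rn n))"
    by (simp add: convolution_Rn_def DoG lebesgue_Rn_def)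
  also have "\<dots> = (\<integral>y. Complex (a y) (b y) * complex_of_real (k y) \<partial>completion (borel_Rn n))"
  proof (rule integral_cong_AE)
    show "(\<lambda>y. u y * complex_of_real (k y)) \<in> borel_measurable (completion (borel_Rn n))"
      using um measurable_completion[OF k] by measurable
    show "(\<lambda>y. Complex (a y) (b y) * complex_of_real (k y)) \<in> borel_measurable (completion (borel_Rn n))"
      by (rule measurable_completion[OF m])
    show "AE y in completion (borel_Rn n). u y * complex_of_real (k y) = Complex (a y) (b y) * complex_of_real (k y)"
      using ae unfolding lebesgue_Rn_def by eventually_elim simp
  qed
  also have "\<dots> = (\<integral>y. Complex (a y) (b y) * complex_of_real (k y) \<partial>borel_Rn n)"
    by (rule integral_completion[OF m])
  also have "\<dots> = (\<integral>y. complex_of_real (k y * a y) + \<i> * complex_of_real (k y * b y) \<partial>borel_Rn n)"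
    by (intro Bochner_Integration.integral_cong) (auto simp: complex_eq_iff)
  also have "\<dots> = (\<integral>y. complex_of_real (k y * a y) \<partial>borel_Rn n) + (\<integral>y. \<i> * complex_of_real (k y * b y) \<partial>borel_Rn n)"
    using int(1)[OF a] int(1)[OF b]
    by (intro Bochner_Integration.integral_add integrable_mult_right) (simp_all only: integrable_of_real)
  also have "\<dots> = complex_of_real (response r \<sigma>0 s a x) + \<i> * complex_of_real (response r \<sigma>0 s b x)"
    using int(2)[OF a] int(2)[OF b] by (simp only: integral_mult_right_zero integral_complex_of_real)
  finally show ?thesis by (simp add: Complex_eq)
qed

lemma convolution_L2_norm:
  assumes a: "a \<in> L2" and b: "b \<in> L2" and u: "u \<in> borel_measurable (lebesgue_Rn n)"
    and ae: "AE x in lebesgue_Rn n. u x = Complex (a x) (b x)"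
    and r: "1 < r" and \<sigma>: "0 < \<sigma>0"
  shows "convolution_Rn n u (DoG_filter n r \<sigma>0 s) \<in> L2_Rn n"
    and "(L2_norm n (convolution_Rn n u (DoG_filter n r \<sigma>0 s)))\<^sup>2 = nsq (response r \<sigma>0 s a) + nsq (response r \<sigma>0 s b)"
proof -
  let ?v = "convolution_Rn n u (DoG_filter n r \<sigma>0 s)"
  note [measurable] = L2D[OF response_L2[OF a]] L2D[OF response_L2[OF b]]
  note eq = convolution_eq[OF a b u ae r \<sigma>]
  have "(\<lambda>x. Complex (response r \<sigma>0 s a x) (response r \<sigma>0 s b x)) \<in> borel_measurable (borel_Rn n)"
    unfolding Complex_eq by measurable
  \<comment> \<open>Equality at every point makes the convolution itself Borel measurable.\<close>
  then have "?v \<in> borel_measurable (borel_Rn n)"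
    by (subst measurable_cong[OF eq])
  then have v: "?v \<in> borel_measurable (lebesgue_Rn n)"
    unfolding lebesgue_Rn_def by (rule measurable_completion)
  have "AE x in lebesgue_Rn n. ?v x = Complex (response r \<sigma>0 s a x) (response r \<sigma>0 s b x)"
    unfolding lebesgue_Rn_def by (rule AE_completion, rule AE_I2) (rule eq)
  note * = response_L2[OF a] response_L2[OF b] v this
  show "?v \<in> L2_Rn n" "(L2_norm n ?v)\<^sup>2 = nsq (response r \<sigma>0 s a) + nsq (response r \<sigma>0 s b)"
    by (rule L2_norm_Complex[OF *])+
qed

end

theorem theorem5p5:
  fixes r \<sigma>0 :: real
  assumes "r > 1" and "\<sigma>0 > 0"
  shows "\<exists>c C :: real. 0 < c \<and> c \<le> C \<and>
    (\<forall>n :: nat. n \<ge> 1 \<longrightarrow> (\<forall>u \<in> L2_Rn n.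
       (\<forall>s :: int. convolution_Rn n u (DoG_filter n r \<sigma>0 s) \<in> L2_Rn n) \<and>
       (\<lambda>s :: int. (L2_norm n (convolution_Rn n u (DoG_filter n r \<sigma>0 s)))\<^sup>2) summable_on UNIV \<and>
       c * (L2_norm n u)\<^sup>2
         \<le> (\<Sum>\<^sub>\<infinity>s :: int. (L2_norm n (convolution_Rn n u (DoG_filter n r \<sigma>0 s)))\<^sup>2) \<and>
       (\<Sum>\<^sub>\<infinity>s :: int. (L2_norm n (convolution_Rn n u (DoG_filter n r \<sigma>0 s)))\<^sup>2)
         \<le> C * (L2_norm n u)\<^sup>2))"
proof -
  \<comment> \<open>The maximum with 1 ensures \<open>1 / K \<le> 1\<close>, that is, c <= C with C
    = 1.\<close>
  define K where "K = max 1 (frame_const (r\<^sup>2))"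
  have K: "1 \<le> K" "frame_const (r\<^sup>2) \<le> K" by (auto simp: K_def)
  show ?thesis
  proof (rule exI[of _ "1 / K"], rule exI[of _ 1], intro conjI allI impI ballI)
    show "0 < 1 / K" "1 / K \<le> 1" using K by auto
    fix n :: nat and u
    assume "1 \<le> n" and u: "u \<in> L2_Rn n"
    interpret heat_space n by standard fact
    obtain a b where ab: "a \<in> L2" "b \<in> L2" and ae: "AE y in lebesgue_Rn n. u y = Complex (a y) (b y)"
      using L2_Rn_representative[OF u] .
    have um: "u \<in> borel_measurable (lebesgue_Rn n)" using u by (simp add: L2_Rn_def)
    note conv = convolution_L2_norm[OF ab um ae assms]
    note fa = response_frame[OF ab(1) assms] and fb = response_frame[OF ab(2) assms]
    let ?v = "\<lambda>s. convolution_Rn n u (DoG_filter n r \<sigma>0 s)"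
    show "?v s \<in> L2_Rn n" for s by (rule conv(1))
    show "(\<lambda>s. (L2_norm n (?v s))\<^sup>2) summable_on UNIV"
      unfolding conv(2) by (rule summable_on_add[OF fa(1) fb(1)])
    have sum: "(\<Sum>\<^sub>\<infinity>s. (L2_norm n (?v s))\<^sup>2) =
        (\<Sum>\<^sub>\<infinity>s. nsq (response r \<sigma>0 s a)) + (\<Sum>\<^sub>\<infinity>s. nsq (response r \<sigma>0 s b))" (is "?S = _")
      unfolding conv(2) by (rule infsum_add[OF fa(1) fb(1)])
    have norm_u: "(L2_norm n u)\<^sup>2 = nsq a + nsq b"
      by (rule L2_norm_Complex(2)[OF ab um ae])
    have "0 \<le> ?S" by (intro infsum_nonneg) simp
    then have "frame_const (r\<^sup>2) * ?S \<le> K * ?S" using K(2) by (rule mult_right_mono[rotated])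
    moreover have "(L2_norm n u)\<^sup>2 \<le> frame_const (r\<^sup>2) * ?S"
      unfolding sum norm_u distrib_left using fa(2) fb(2) by (rule add_mono)
    ultimately show "1 / K * (L2_norm n u)\<^sup>2 \<le> ?S" using K(1) by (simp add: field_simps)
    show "?S \<le> 1 * (L2_norm n u)\<^sup>2" unfolding sum norm_u using fa(3) fb(3) by simp
  qed
qed

end
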